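(* Let $0<\beta<1$ and $p=\lceil\beta^{-1}\rceil-1$. Let $G$ be a graph of order $n$ with minimum degree $(1-\beta)n$ (an integer). Then for every integer $2\le t\le p$, $$\frac{k_{p+1}(G)}{g_{p+1}(\beta)n^{p+1}}\ge\frac{k_t(G)}{g_t(\beta)n^t}.$$ Moreover, for $t=2$ equality holds if and only if $(n,\beta)$ is feasible and $G\in\mathcal{G}(n,\beta)$.
   Context: All graphs are finite and simple; $k_r(G)$ is the number of $r$-cliques of $G$. For $0<\beta<1$, $p=\lceil\beta^{-1}\rceil-1$ and integers $r$, define $$g_r(\beta)=\binom{p-1}{r}\beta^{r}+\binom{p-1}{r-1}(1-(p-1)\beta)\beta^{r-1}+\frac12\binom{p-1}{r-2}(1-p\beta)(1-(p-1)\beta)\beta^{r-2},$$ where $\binom{x}{y}=0$ if $x<y$ or $y<0$. The family $\mathcal{G}(n,\beta)$ (defined only when $n$ and $(1-\beta)n$ are positive integers not both odd) consists of all graphs $G$ on vertex set $V$, $|V|=n$, admitting a partition $V=V_0\cup V_1\cup\dots\cup V_{p-1}$ with $|V_0|=(1-(p-1)\beta)n$ and $|V_i|=\beta n$ for $1\le i\le p-1$, such that: all edges between $V_i$ and $V_j$ are present for $0\le i<j\le p-1$; $V_i$ is independent for $1\le i\le p-1$; and $G[V_0]$ is $(1-p\beta)n$-regular with minimum number of triangles among all $(1-p\beta)n$-regular graphs on $|V_0|$ vertices. The pair $(n,\beta)$ is feasible if $\mathcal{G}(n,\beta)$ is defined and $G[V_0]$ is triangle-free for $G\in\mathcal{G}(n,\beta)$.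 *)

theory Defs
  imports Complex_Main
begin

definition simple_graph :: "'a set \<Rightarrow> ('a \<Rightarrow> 'a \<Rightarrow> bool) \<Rightarrow> bool" where
  "simple_graph V E \<longleftrightarrow> finite V \<and> (\<forall>x y. E x y \<longrightarrow> x \<in> V \<and> y \<in> V)
     \<and> (\<forall>x y. E x y \<longrightarrow> E y x) \<and> (\<forall>x. \<not> E x x)"

definition degree :: "'a set \<Rightarrow> ('a \<Rightarrow> 'a \<Rightarrow> bool) \<Rightarrow> 'a \<Rightarrow> nat" where
  "degree V E v = card {u \<in> V. E v u}"

definition min_degree :: "'a set \<Rightarrow> ('a \<Rightarrow> 'a \<Rightarrow> bool) \<Rightarrow> nat" where
  "min_degree V E = Min (degree V E ` V)"

definition kcliques :: "'a set \<Rightarrow> ('a \<Rightarrow> 'a \<Rightarrow> bool) \<Rightarrow> nat \<Rightarrow> nat" where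
  "kcliques V E r = card {S. S \<subseteq> V \<and> card S = r \<and> (\<forall>x\<in>S. \<forall>y\<in>S. x \<noteq> y \<longrightarrow> E x y)}"

definition binom :: "int \<Rightarrow> int \<Rightarrow> real" where
  "binom x y = (if y < 0 \<or> x < y then 0 else real (nat x choose nat y))"

definition pnum :: "real \<Rightarrow> int" where
  "pnum \<beta> = \<lceil>1 / \<beta>\<rceil> - 1"

definition g :: "int \<Rightarrow> real \<Rightarrow> real" where
  "g r \<beta> = (let p = pnum \<beta> in
      binom (p - 1) r * \<beta> ^ nat r
    + binom (p - 1) (r - 1) * (1 - real_of_int (p - 1) * \<beta>) * \<beta> ^ nat (r - 1)
    + 1/2 * binom (p - 1) (r - 2) * (1 - real_of_int p * \<beta>) * (1 - real_of_int (p - 1) * \<beta>)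
        * \<beta> ^ nat (r - 2))"

definition family_defined :: "nat \<Rightarrow> real \<Rightarrow> bool" where
  "family_defined n \<beta> \<longleftrightarrow> n > 0 \<and>
     (\<exists>d::nat. d > 0 \<and> real d = (1 - \<beta>) * real n \<and> \<not> (odd n \<and> odd d))"

definition regular :: "'a set \<Rightarrow> ('a \<Rightarrow> 'a \<Rightarrow> bool) \<Rightarrow> real \<Rightarrow> bool" where
  "regular V E r \<longleftrightarrow> (\<forall>v\<in>V. real (degree V E v) = r)"

text \<open>The partition V_0,...,V_{p-1} is given by a map part with V_i = {v \<in> V. part v = i};
  family_witness V E \<beta> part says this partition witnesses (V,E) \<in> \<G>(|V|,\<beta>).\<close>
definition family_witness :: "'a set \<Rightarrow> ('a \<Rightarrow> 'a \<Rightarrow> bool) \<Rightarrow> real \<Rightarrow> ('a \<Rightarrow> nat) \<Rightarrow> bool" where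
  "family_witness V E \<beta> part \<longleftrightarrow> (let n = card V; p = nat (pnum \<beta>);
        V0 = {v \<in> V. part v = 0}; r = (1 - real p * \<beta>) * real n in
        (\<forall>v\<in>V. part v < p) \<and>
        real (card V0) = (1 - real (p - 1) * \<beta>) * real n \<and>
        (\<forall>i\<in>{1..<p}. real (card {v \<in> V. part v = i}) = \<beta> * real n) \<and>
        (\<forall>x\<in>V. \<forall>y\<in>V. part x \<noteq> part y \<longrightarrow> E x y) \<and>
        (\<forall>x\<in>V. \<forall>y\<in>V. part x = part y \<and> part x \<ge> 1 \<longrightarrow> \<not> E x y) \<and>
        regular V0 E r \<and>
        (\<forall>F :: nat \<Rightarrow> nat \<Rightarrow> bool. simple_graph {0..<card V0} F \<and> regular {0..<card V0} F r
               \<longrightarrow> kcliques V0 E 3 \<le> kcliques {0..<card V0} F 3))"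

definition in_family :: "'a set \<Rightarrow> ('a \<Rightarrow> 'a \<Rightarrow> bool) \<Rightarrow> real \<Rightarrow> bool" where
  "in_family V E \<beta> \<longleftrightarrow> family_defined (card V) \<beta> \<and> simple_graph V E \<and>
     (\<exists>part. family_witness V E \<beta> part)"

text \<open>(n,\<beta>) feasible: \<G>(n,\<beta>) defined and G[V_0] triangle-free for every G in it
  (graphs taken on the vertex set {0..<n}; the family is isomorphism invariant).\<close>
definition feasible :: "nat \<Rightarrow> real \<Rightarrow> bool" where
  "feasible n \<beta> \<longleftrightarrow> family_defined n \<beta> \<and>
     (\<forall>(E :: nat \<Rightarrow> nat \<Rightarrow> bool) part. simple_graph {0..<n} E \<and> family_witness {0..<n} E \<beta> part
        \<longrightarrow> kcliques {v \<in> {0..<n}. part v = 0} E 3 = 0)"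

end

theory Submission
  imports Defs
begin

text \<open>
  Write \<open>n = |V|\<close> and \<open>m = \<beta> n\<close>, so that every \<open>s\<close>-clique has at least \<open>n - s m\<close> common neighbours. In an
  extremal graph an \<open>s\<close>-clique has either exactly that many, or \<open>(p + 1 - s) m\<close>. Truncating the
  codegree of every \<open>s\<close>-clique at the latter value, double counting over the facets of an
  \<open>(s + 1)\<close>-clique gives linear inequalities between clique counts and sums of truncated
  codegrees in which the extremal graphs attain equality. The truncated codegree of a
  \<open>(p + 1)\<close>-clique is \<open>0\<close>, so the system closes without any assumption on \<open>(p + 2)\<close>-cliques, and
  backward induction on \<open>s\<close> solves it. If equality holds for edges, then every inequality
  is tight: the graph is regular, has no \<open>(p + 2)\<close>-clique, and the facets of any one
  \<open>(p + 1)\<close>-clique exhibit the partition.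
\<close>

section \<open>Cliques and common neighbourhoods\<close>

definition cliques :: "'a set \<Rightarrow> ('a \<Rightarrow> 'a \<Rightarrow> bool) \<Rightarrow> nat \<Rightarrow> 'a set set" where
  "cliques V E r = {S. S \<subseteq> V \<and> card S = r \<and> (\<forall>x\<in>S. \<forall>y\<in>S. x \<noteq> y \<longrightarrow> E x y)}"

lemma kcliques_eq_card: "kcliques V E r = card (cliques V E r)"
  by (simp add: kcliques_def cliques_def)

lemma finite_cliques: "finite V \<Longrightarrow> finite (cliques V E r)"
  by (rule finite_subset[of _ "Pow V"]) (auto simp: cliques_def)

definition common :: "'a set \<Rightarrow> ('a \<Rightarrow> 'a \<Rightarrow> bool) \<Rightarrow> 'a set \<Rightarrow> 'a set" where
  "common V E A = {v \<in> V. \<forall>u\<in>A. E v u}"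

text \<open>A vertex counts as its own non-neighbour, so a degree of at least \<open>n - m\<close>
  leaves at most \<open>m\<close> elements here, with no correction term.\<close>

definition nonnbrs :: "'a set \<Rightarrow> ('a \<Rightarrow> 'a \<Rightarrow> bool) \<Rightarrow> 'a \<Rightarrow> 'a set" where
  "nonnbrs V E u = {v \<in> V. \<not> E v u}"

lemma simple_graph_sym: "simple_graph V E \<Longrightarrow> E x y \<longleftrightarrow> E y x"
  by (auto simp: simple_graph_def)

lemma simple_graph_irrefl: "simple_graph V E \<Longrightarrow> \<not> E x x"
  by (auto simp: simple_graph_def)

lemma simple_graph_finite: "simple_graph V E \<Longrightarrow> finite V"
  by (auto simp: simple_graph_def)

lemma insert_common_in_cliques:
  assumes G: "simple_graph V E" and T: "T \<in> cliques V E s" and v: "v \<in> common V E T"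
  shows "insert v T \<in> cliques V E (Suc s)" "v \<notin> T"
proof -
  have fin: "finite T"
    using T finite_subset[OF _ simple_graph_finite[OF G]] by (auto simp: cliques_def)
  show nv: "v \<notin> T"
    using v simple_graph_irrefl[OF G] by (auto simp: common_def)
  show "insert v T \<in> cliques V E (Suc s)"
    using T v fin nv simple_graph_sym[OF G] unfolding cliques_def common_def by fastforce
qed

lemma remove_from_clique:
  assumes G: "simple_graph V E" and S: "S \<in> cliques V E (Suc s)" and v: "v \<in> S"
  shows "S - {v} \<in> cliques V E s" "v \<in> common V E (S - {v})"
proof -
  have fin: "finite S"
    using S finite_subset[OF _ simple_graph_finite[OF G]] by (auto simp: cliques_def)
  show "S - {v} \<in> cliques V E s"
    using S v fin by (auto simp: cliques_def)
  show "v \<in> common V E (S - {v})"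
    using S v by (auto simp: cliques_def common_def)
qed

text \<open>Deleting a vertex from an (s + 1)-clique and adding a common neighbour to an s-clique
  are inverse to each other. They match the pairs \<open>(S, v)\<close> with \<open>v\<close> in
  \<open>S\<close> to the pairs \<open>(T, v)\<close> with \<open>v\<close> in
  \<open>common V E T\<close>.\<close>

lemma sum_over_facets:
  fixes h :: "'a set \<Rightarrow> real"
  assumes G: "simple_graph V E"
  shows "(\<Sum>S\<in>cliques V E (Suc s). \<Sum>v\<in>S. h (S - {v}))
       = (\<Sum>T\<in>cliques V E s. real (card (common V E T)) * h T)"
proof -
  have fV: "finite V" using simple_graph_finite[OF G] .
  have "(\<Sum>S\<in>cliques V E (Suc s). \<Sum>v\<in>S. h (S - {v}))
      = (\<Sum>(S, v)\<in>Sigma (cliques V E (Suc s)) (\<lambda>S. S). h (S - {v}))"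
    using fV by (intro sum.Sigma finite_cliques) (auto simp: cliques_def intro: finite_subset)
  also have "\<dots> = (\<Sum>(T, v)\<in>Sigma (cliques V E s) (common V E). h T)"
  proof (rule sum.reindex_bij_witness[where i = "\<lambda>(T, v). (insert v T, v)" and j = "\<lambda>(S, v). (S - {v}, v)"])
    fix a assume "a \<in> Sigma (cliques V E (Suc s)) (\<lambda>S. S)"
    then obtain S v where a: "a = (S, v)" and S: "S \<in> cliques V E (Suc s)" and v: "v \<in> S" by blast
    show "(case case a of (S, v) \<Rightarrow> (S - {v}, v) of (T, v) \<Rightarrow> (insert v T, v)) = a"
      using v by (simp add: a insert_absorb)
    show "(case a of (S, v) \<Rightarrow> (S - {v}, v)) \<in> Sigma (cliques V E s) (common V E)"
      using remove_from_clique[OF G S v] by (simp add: a)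
    show "(case case a of (S, v) \<Rightarrow> (S - {v}, v) of (T, v) \<Rightarrow> h T) = (case a of (S, v) \<Rightarrow> h (S - {v}))"
      by (simp add: a)
  next
    fix b assume "b \<in> Sigma (cliques V E s) (common V E)"
    then obtain T v where b: "b = (T, v)" and T: "T \<in> cliques V E s" and v: "v \<in> common V E T" by blast
    show "(case case b of (T, v) \<Rightarrow> (insert v T, v) of (S, v) \<Rightarrow> (S - {v}, v)) = b"
      using insert_common_in_cliques(2)[OF G T v] by (simp add: b)
    show "(case b of (T, v) \<Rightarrow> (insert v T, v)) \<in> Sigma (cliques V E (Suc s)) (\<lambda>S. S)"
      using insert_common_in_cliques(1)[OF G T v] by (simp add: b)
  qed
  also have "\<dots> = (\<Sum>T\<in>cliques V E s. \<Sum>v\<in>common V E T. h T)"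
    using fV by (intro sum.Sigma[symmetric] finite_cliques) (auto simp: common_def)
  finally show ?thesis by simp
qed

lemma sum_card_common:
  assumes "simple_graph V E"
  shows "(\<Sum>T\<in>cliques V E s. real (card (common V E T))) = real (Suc s) * real (kcliques V E (Suc s))"
proof -
  have "(\<Sum>T\<in>cliques V E s. real (card (common V E T)))
      = (\<Sum>S\<in>cliques V E (Suc s). \<Sum>v\<in>S. (1::real))"
    using sum_over_facets[OF assms, of "\<lambda>_. 1" s] by simp
  also have "\<dots> = (\<Sum>S\<in>cliques V E (Suc s). real (Suc s))"
    by (intro sum.cong) (auto simp: cliques_def)
  finally show ?thesis by (simp add: kcliques_eq_card)
qed

text \<open>Checked for one vertex \<open>v\<close> at a time, by the number of members of
  \<open>S\<close> that \<open>v\<close> misses. If it misses none, it contributes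
  \<open>s + 1\<close> to both sides; if one, 2 to both sides; if two or more, 2 on the left and at
  least 2 on the right, from the second sum alone.\<close>

lemma sum_card_remove_lower_bound:
  assumes G: "simple_graph V E" and S: "S \<subseteq> V" "card S = Suc s" and s: "1 \<le> s"
  shows "2 * real (card V) + (real s - 1) * real (card (common V E S))
       \<le> (\<Sum>u\<in>S. real (card (common V E (S - {u})))) + (\<Sum>u\<in>S. real (card (nonnbrs V E u)))"
proof -
  have fV: "finite V" using simple_graph_finite[OF G] .
  have fS: "finite S" using S fV finite_subset by blast
  define M where "M v = {u \<in> S. \<not> E v u}" for v
  have card_as_sum: "real (card {v \<in> V. P v}) = (\<Sum>v\<in>V. of_bool (P v))" for P
    using fV by (simp add: sum.If_cases of_bool_def Int_def)
  have pointwise: "2 + (real s - 1) * of_bool (M v = {})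
      \<le> (\<Sum>u\<in>S. of_bool (M v \<subseteq> {u})) + (\<Sum>u\<in>S. of_bool (\<not> E v u))" for v
  proof -
    have c: "(\<Sum>u\<in>S. of_bool (\<not> E v u)) = real (card (M v))"
      using fS by (simp add: M_def sum.If_cases of_bool_def Int_def)
    have fM: "finite (M v)" using fS by (simp add: M_def)
    have "card (M v) = 0 \<or> card (M v) = 1 \<or> 2 \<le> card (M v)" by linarith
    then consider "M v = {}" | w where "M v = {w}" | "2 \<le> card (M v)"
      using fM by (auto simp: card_1_singleton_iff)
    then show ?thesis
    proof cases
      case 1
      then show ?thesis using S by (simp add: c)
    next
      case 2
      have "w \<in> S" using 2 by (auto simp: M_def)
      moreover have "(\<Sum>u\<in>S. of_bool (M v \<subseteq> {u})) = (\<Sum>u\<in>S. if u = w then 1 else (0::real))"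
        using 2 by (intro sum.cong) auto
      ultimately show ?thesis using 2 fS by (simp add: c)
    next
      case 3
      have "(\<Sum>u\<in>S. of_bool (M v \<subseteq> {u})) \<ge> (0::real)" by (intro sum_nonneg) auto
      moreover have "M v \<noteq> {}" using 3 by auto
      ultimately show ?thesis using 3 by (simp add: c)
    qed
  qed
  have "(\<Sum>v\<in>V. 2 + (real s - 1) * of_bool (M v = {}))
      \<le> (\<Sum>v\<in>V. (\<Sum>u\<in>S. of_bool (M v \<subseteq> {u})) + (\<Sum>u\<in>S. of_bool (\<not> E v u)))"
    by (intro sum_mono pointwise)
  also have "\<dots> = (\<Sum>u\<in>S. \<Sum>v\<in>V. of_bool (M v \<subseteq> {u})) + (\<Sum>u\<in>S. \<Sum>v\<in>V. of_bool (\<not> E v u))"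
    unfolding sum.distrib by (intro arg_cong2[where f = "(+)"] sum.swap)
  also have "(\<Sum>v\<in>V. 2 + (real s - 1) * of_bool (M v = {}))
      = 2 * real (card V) + (real s - 1) * (\<Sum>v\<in>V. of_bool (M v = {}))"
    by (simp add: sum.distrib sum_distrib_left)
  also have "(\<Sum>v\<in>V. of_bool (M v = {})) = real (card (common V E S))"
    unfolding card_as_sum[symmetric] common_def M_def by (intro arg_cong[where f = "\<lambda>A. real (card A)"]) auto
  also have "(\<Sum>u\<in>S. \<Sum>v\<in>V. of_bool (M v \<subseteq> {u})) = (\<Sum>u\<in>S. real (card (common V E (S - {u}))))"
    unfolding card_as_sum[symmetric] common_def M_def
    by (intro sum.cong refl arg_cong[where f = "\<lambda>A. real (card A)"]) auto
  also have "(\<Sum>u\<in>S. \<Sum>v\<in>V. of_bool (\<not> E v u)) = (\<Sum>u\<in>S. real (card (nonnbrs V E u)))"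
    unfolding card_as_sum[symmetric] nonnbrs_def by simp
  finally show ?thesis .
qed

lemma card_nonnbrs:
  assumes G: "simple_graph V E"
  shows "real (card (nonnbrs V E u)) = real (card V) - real (degree V E u)"
proof -
  have fV: "finite V" using simple_graph_finite[OF G] .
  have "nonnbrs V E u = V - {v \<in> V. E u v}"
    using simple_graph_sym[OF G, of u] by (auto simp: nonnbrs_def)
  then show ?thesis
    using fV by (simp add: degree_def card_Diff_subset of_nat_diff card_mono)
qed

text \<open>The handshake lemma, obtained as the case \<open>s = 1\<close> of
  \<open>sum_card_common\<close>.\<close>

lemma sum_degree_eq:
  assumes G: "simple_graph V E"
  shows "(\<Sum>v\<in>V. degree V E v) = 2 * kcliques V E 2"
proof -
  have "cliques V E 1 = (\<lambda>v. {v}) ` V"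
    by (auto simp: cliques_def card_1_singleton_iff)
  then have "(\<Sum>T\<in>cliques V E 1. real (card (common V E T))) = (\<Sum>v\<in>V. real (card (common V E {v})))"
    by (simp add: sum.reindex)
  moreover have "common V E {v} = {u \<in> V. E v u}" for v
    using simple_graph_sym[OF G, of v] by (auto simp: common_def)
  ultimately have "real (\<Sum>v\<in>V. degree V E v) = real (2 * kcliques V E 2)"
    using sum_card_common[OF G, of 1] by (simp add: degree_def numeral_2_eq_2)
  then show ?thesis by linarith
qed

section \<open>The clique counts of the extremal graphs\<close>

text \<open>Absorption over the reals. For \<open>j > q\<close> both binomial coefficients vanish,
  so no bound on \<open>j\<close> has to be carried along.\<close>

lemma choose_Suc_mult:
  "real (Suc j) * real (q choose Suc j) = (real q - real j) * real (q choose j)"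
proof (cases "j \<le> q")
  case True
  have "Suc j * (q choose Suc j) = (q - j) * (q choose j)"
    by (simp only: binomial_absorption binomial_absorb_comp)
  then have "real (Suc j * (q choose Suc j)) = real ((q - j) * (q choose j))" by (rule arg_cong)
  then show ?thesis using True by (simp only: of_nat_mult of_nat_diff)
qed (simp add: binomial_eq_0)

text \<open>The paper's \<open>g\<^sub>s(\<beta>) n\<^sup>s\<close> is \<open>ref (p - 1) n (\<beta> n) s\<close> for \<open>s \<ge> 2\<close>, and \<open>ref_light\<close> collects the
  \<open>s\<close>-cliques of an extremal graph with at most one vertex in \<open>V\<^sub>0\<close>, which have only \<open>n - s m\<close> common
  neighbours. Both are meaningless for \<open>s < 2\<close>, where the subtractions truncate.\<close>

definition ref :: "nat \<Rightarrow> real \<Rightarrow> real \<Rightarrow> nat \<Rightarrow> real" where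
  "ref q n m s = real (q choose s) * m ^ s + real (q choose (s - 1)) * (n - real q * m) * m ^ (s - 1)
     + 1/2 * real (q choose (s - 2)) * (n - (real q + 1) * m) * (n - real q * m) * m ^ (s - 2)"

definition ref_light :: "nat \<Rightarrow> real \<Rightarrow> real \<Rightarrow> nat \<Rightarrow> real" where
  "ref_light q n m s = real (q choose s) * m ^ s + real (q choose (s - 1)) * (n - real q * m) * m ^ (s - 1)"

text \<open>In an extremal graph with \<open>p = q + 1\<close> the left side sums, over all
  s-cliques, the difference between \<open>(p + 1 - s) m\<close> and the codegree. That difference
  is \<open>(p + 1) m - n\<close> for the cliques counted by \<open>ref_light\<close> and zero for
  the others. The identity holds for all real \<open>n\<close> and \<open>m\<close>, so the proof is
  algebraic.\<close>

lemma ref_gap: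
  assumes "2 \<le> s"
  shows "(real q + 2 - real s) * m * ref q n m s - real (Suc s) * ref q n m (Suc s)
       = ((real q + 2) * m - n) * ref_light q n m s"
proof -
  obtain j where s: "s = Suc (Suc j)" using assms by (metis add_2_eq_Suc le_Suc_ex)
  define A B C D M x y where "A = real (q choose j)" "B = real (q choose Suc j)" "C = real (q choose Suc (Suc j))"
    "D = real (q choose Suc (Suc (Suc j)))" "M = m ^ j" "x = real j" "y = real q"
  note d = this
  have *: "(x + 1) * B = (y - x) * A" "(x + 2) * C = (y - x - 1) * B" "(x + 3) * D = (y - x - 2) * C"
    using choose_Suc_mult[of j q] choose_Suc_mult[of "Suc j" q] choose_Suc_mult[of "Suc (Suc j)" q]
    unfolding d by (simp_all add: algebra_simps)
  have e: "2 * ref q n m s = 2 * C * M*m*m + 2 * B * (n - y * m) * M*m + A * (n - (y+1)*m) * (n - y * m) * M"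
    "2 * ref q n m (Suc s) = 2 * D * M*m*m*m + 2 * C * (n - y * m) * M*m*m + B * (n - (y+1)*m) * (n - y * m) * M*m"
    "ref_light q n m s = C * M*m*m + B * (n - y * m) * M*m"
    unfolding ref_def ref_light_def s d by (simp_all add: field_simps)
  \<comment> \<open>Everything is doubled to clear the factor 1/2. The difference of the two sides
    is then a combination of the residuals of the three absorption identities collected
    before.\<close>
  have "(y - x) * m * (2 * C * M*m*m + 2 * B * (n - y * m) * M*m + A * (n - (y+1)*m) * (n - y * m) * M)
     - (x + 3) * (2 * D * M*m*m*m + 2 * C * (n - y * m) * M*m*m + B * (n - (y+1)*m) * (n - y * m) * M*m)
     - 2 * (((y+2) * m - n) * (C * M*m*m + B * (n - y * m) * M*m))
     = m * (n - (y+1)*m) * (n - y * m) * M * ((y - x) * A - (x + 1) * B)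
     + 2 * (n - y * m) * M * m * m * ((y - x - 1) * B - (x + 2) * C)
     + 2 * M * m * m * m * ((y - x - 2) * C - (x + 3) * D)"
    by algebra
  then have "(y - x) * m * (2 * ref q n m s) - (x + 3) * (2 * ref q n m (Suc s))
       = 2 * (((y+2) * m - n) * ref_light q n m s)"
    unfolding e using * by simp
  then show ?thesis
    unfolding s by (simp add: d algebra_simps)
qed

text \<open>Both sides count the pairs of an (s + 1)-clique of an extremal graph and a facet with at
  most one vertex in \<open>V0\<close>. All \<open>s + 1\<close> facets qualify if the clique itself
  has at most one vertex in \<open>V0\<close>, and exactly two if it has two.\<close>

lemma ref_light_step:
  assumes "2 \<le> s"
  shows "(n - real s * m) * ref_light q n m s
       = (real s - 1) * ref_light q n m (Suc s) + 2 * ref q n m (Suc s)"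
proof -
  obtain j where s: "s = Suc (Suc j)" using assms by (metis add_2_eq_Suc le_Suc_ex)
  define B C D M x y where "B = real (q choose Suc j)" "C = real (q choose Suc (Suc j))"
    "D = real (q choose Suc (Suc (Suc j)))" "M = m ^ j" "x = real j" "y = real q"
  note d = this
  have *: "(x + 2) * C = (y - x - 1) * B" "(x + 3) * D = (y - x - 2) * C"
    using choose_Suc_mult[of "Suc j" q] choose_Suc_mult[of "Suc (Suc j)" q]
    unfolding d by (simp_all add: algebra_simps)
  have "2 * ref q n m (Suc s) = 2 * D * M*m*m*m + 2 * C * (n - y * m) * M*m*m + B * (n - (y+1)*m) * (n - y * m) * M*m"
    "ref_light q n m s = C * M*m*m + B * (n - y * m) * M*m"
    "ref_light q n m (Suc s) = D * M*m*m*m + C * (n - y * m) * M*m*m"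
    unfolding ref_def ref_light_def s d by (simp_all add: field_simps)
  moreover have "(n - (x + 2) * m) * (C * M*m*m + B * (n - y * m) * M*m)
     - (x + 1) * (D * M*m*m*m + C * (n - y * m) * M*m*m)
     - (2 * D * M*m*m*m + 2 * C * (n - y * m) * M*m*m + B * (n - (y+1)*m) * (n - y * m) * M*m)
     = M * m * m * m * ((y - x - 2) * C - (x + 3) * D)
     + (n - y * m) * M * m * m * ((y - x - 1) * B - (x + 2) * C)"
    by algebra
  ultimately have "(n - (x + 2) * m) * ref_light q n m s
     = (x + 1) * ref_light q n m (Suc s) + 2 * ref q n m (Suc s)"
    using * by simp
  then show ?thesis
    unfolding s by (simp add: d algebra_simps)
qed

section \<open>Clique counts under isomorphisms and joins\<close>

lemma kcliques_bij:
  assumes h: "bij_betw h A B" and F: "\<And>x y. x \<in> A \<Longrightarrow> y \<in> A \<Longrightarrow> F x y \<longleftrightarrow> E (h x) (h y)"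
  shows "kcliques A F r = kcliques B E r"
proof -
  have inj: "inj_on h A" and im: "h ` A = B" using h by (auto simp: bij_betw_def)
  have "cliques B E r = (`) h ` cliques A F r"
  proof (intro subset_antisym subsetI)
    fix S assume S: "S \<in> cliques B E r"
    define T where "T = {x \<in> A. h x \<in> S}"
    have hT: "h ` T = S" using S im by (auto simp: T_def cliques_def)
    moreover have "card T = card S"
    proof -
      have "inj_on h T" using inj by (rule inj_on_subset) (auto simp: T_def)
      then show ?thesis using card_image hT by metis
    qed
    moreover have "F x y" if "x \<in> T" "y \<in> T" "x \<noteq> y" for x y
    proof -
      have "x \<in> A" "y \<in> A" "h x \<in> S" "h y \<in> S" using that by (auto simp: T_def)
      moreover have "h x \<noteq> h y" using inj that(3) \<open>x \<in> A\<close> \<open>y \<in> A\<close> by (meson inj_onD)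
      ultimately show ?thesis using S F by (simp add: cliques_def)
    qed
    ultimately have "T \<in> cliques A F r"
      using S by (simp add: cliques_def) (simp add: T_def)
    then show "S \<in> (`) h ` cliques A F r" using hT by blast
  next
    fix S assume "S \<in> (`) h ` cliques A F r"
    then obtain T where T: "T \<in> cliques A F r" "S = h ` T" by blast
    have "card (h ` T) = card T"
      using T inj by (intro card_image) (auto simp: cliques_def intro: inj_on_subset)
    moreover have "E (h x) (h y)" if "x \<in> T" "y \<in> T" "h x \<noteq> h y" for x y
    proof -
      have "x \<noteq> y" "x \<in> A" "y \<in> A" using that T by (auto simp: cliques_def)
      then show ?thesis using that T F[of x y] by (simp add: cliques_def)
    qed
    moreover have "h ` T \<subseteq> B" using T im by (auto simp: cliques_def)
    ultimately show "S \<in> cliques B E r"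
      using T by (auto simp: cliques_def)
  qed
  moreover have "inj_on ((`) h) (cliques A F r)"
    using inj by (intro inj_on_subset[OF inj_on_image_Pow[OF inj]]) (auto simp: cliques_def)
  ultimately show ?thesis by (simp add: kcliques_eq_card card_image)
qed

lemma degree_bij:
  assumes h: "bij_betw h A B" and F: "\<And>y. y \<in> A \<Longrightarrow> F v y \<longleftrightarrow> E (h v) (h y)"
  shows "degree A F v = degree B E (h v)"
proof -
  have "bij_betw h {u \<in> A. F v u} {u \<in> B. E (h v) u}"
    using h F by (auto simp: bij_betw_def intro: inj_on_subset)
  then show ?thesis unfolding degree_def by (rule bij_betw_same_card)
qed

lemma kcliques_1: "kcliques V E 1 = card V"
proof -
  have "cliques V E 1 = (\<lambda>v. {v}) ` V"
    by (auto simp: cliques_def card_1_singleton_iff)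
  then show ?thesis by (simp add: kcliques_eq_card card_image)
qed

text \<open>A clique meets the independent set \<open>B\<close> in at most one vertex. So it either
  lies in \<open>U\<close> or arises from a clique of \<open>U\<close> by adding an arbitrary vertex
  of \<open>B\<close>.\<close>

lemma kcliques_join_independent:
  assumes fin: "finite U" "finite B" and disj: "U \<inter> B = {}"
    and join: "\<And>u b. u \<in> U \<Longrightarrow> b \<in> B \<Longrightarrow> E u b \<and> E b u"
    and indep: "\<And>a b. a \<in> B \<Longrightarrow> b \<in> B \<Longrightarrow> \<not> E a b"
  shows "kcliques (U \<union> B) E (Suc r) = kcliques U E (Suc r) + card B * kcliques U E r"
proof -
  let ?f = "\<lambda>(b, T). insert b T"
  have fin_sub: "finite T" if "T \<subseteq> U \<union> B" for T
    using that fin finite_subset by blast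
  have split: "cliques (U \<union> B) E (Suc r) = cliques U E (Suc r) \<union> ?f ` (B \<times> cliques U E r)"
  proof (intro subset_antisym subsetI)
    fix S assume S: "S \<in> cliques (U \<union> B) E (Suc r)"
    show "S \<in> cliques U E (Suc r) \<union> ?f ` (B \<times> cliques U E r)"
    proof (cases "S \<inter> B = {}")
      case True
      then show ?thesis using S by (auto simp: cliques_def)
    next
      case False
      then obtain b where b: "b \<in> S" "b \<in> B" by blast
      have fS: "finite S" using S fin_sub by (simp add: cliques_def)
      have "S - {b} \<subseteq> U"
      proof
        fix a assume a: "a \<in> S - {b}"
        then have "E a b" using S b by (auto simp: cliques_def)
        then have "a \<notin> B" using indep b by blast
        then show "a \<in> U" using a S by (auto simp: cliques_def)
      qed
      then have "S - {b} \<in> cliques U E r" using S b fS by (auto simp: cliques_def)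
      then have "?f (b, S - {b}) \<in> ?f ` (B \<times> cliques U E r)" using b by blast
      then show ?thesis using b by (simp add: insert_absorb)
    qed
  next
    fix S assume "S \<in> cliques U E (Suc r) \<union> ?f ` (B \<times> cliques U E r)"
    then show "S \<in> cliques (U \<union> B) E (Suc r)"
    proof
      assume "S \<in> cliques U E (Suc r)"
      then show ?thesis by (auto simp: cliques_def)
    next
      assume "S \<in> ?f ` (B \<times> cliques U E r)"
      then obtain b T where bT: "b \<in> B" "T \<in> cliques U E r" "S = insert b T" by auto
      have "b \<notin> T" "finite T" using bT disj fin_sub[of T] by (auto simp: cliques_def)
      moreover have "E b u \<and> E u b" if "u \<in> T" for u
        using bT that join[of u b] by (auto simp: cliques_def)
      ultimately show ?thesis using bT by (auto simp: cliques_def)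
    qed
  qed
  have disjoint: "cliques U E (Suc r) \<inter> ?f ` (B \<times> cliques U E r) = {}"
    using disj by (auto simp: cliques_def)
  have inj: "inj_on ?f (B \<times> cliques U E r)"
  proof (rule inj_onI)
    fix x y assume x: "x \<in> B \<times> cliques U E r" and y: "y \<in> B \<times> cliques U E r" and eq: "?f x = ?f y"
    obtain b T c R where xy: "x = (b, T)" "y = (c, R)" by fastforce
    have "b \<notin> T" "b \<notin> R" "c \<notin> T" "c \<notin> R"
      using x y disj unfolding xy cliques_def by auto
    moreover have "insert b T = insert c R" using eq xy by simp
    ultimately have "b = c \<and> T = R" by (metis insertE insertI1 insert_ident)
    then show "x = y" using xy by simp
  qed
  have "card (cliques (U \<union> B) E (Suc r)) = card (cliques U E (Suc r)) + card (?f ` (B \<times> cliques U E r))"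
    unfolding split using fin finite_cliques by (intro card_Un_disjoint disjoint) auto
  also have "card (?f ` (B \<times> cliques U E r)) = card B * card (cliques U E r)"
    using card_image[OF inj] by (simp add: card_cartesian_product)
  finally show ?thesis by (simp add: kcliques_eq_card)
qed

text \<open>Regularity counts the edges inside \<open>V0\<close>; the independent classes are then
  joined to \<open>V0\<close> one after the other.\<close>

lemma kcliques_extremal:
  fixes V :: "'a set" and part :: "'a \<Rightarrow> nat" and m :: real
  defines "n \<equiv> real (card V)" and "V0 \<equiv> {v \<in> V. part v = 0}"
  assumes G: "simple_graph V E" and p: "2 \<le> p"
    and less: "\<And>v. v \<in> V \<Longrightarrow> part v < p"
    and parts: "\<And>i. i \<in> {1..<p} \<Longrightarrow> real (card {v \<in> V. part v = i}) = m"
    and V0: "real (card V0) = n - (real p - 1) * m"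
    and complete: "\<And>x y. x \<in> V \<Longrightarrow> y \<in> V \<Longrightarrow> part x \<noteq> part y \<Longrightarrow> E x y"
    and indep: "\<And>x y. x \<in> V \<Longrightarrow> y \<in> V \<Longrightarrow> part x = part y \<Longrightarrow> 1 \<le> part x \<Longrightarrow> \<not> E x y"
    and reg: "\<And>v. v \<in> V0 \<Longrightarrow> real (degree V0 E v) = n - real p * m"
    and triangle_free: "kcliques V0 E 3 = 0"
  shows "real (kcliques V E (Suc p)) = ref (p - 1) n m (Suc p)"
    and "real (kcliques V E 2) = ref (p - 1) n m 2"
proof -
  define e where "e = real (kcliques V0 E 2)"
  have e: "e = 1/2 * (n - real p * m) * (n - (real p - 1) * m)"
  proof -
    \<comment> \<open>Edges of \<open>E\<close> may leave \<open>V0\<close>. The restriction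
      \<open>F\<close> is a simple graph on \<open>V0\<close> with the same degrees and cliques
      there, so the handshake lemma applies to it.\<close>
    define F where "F x y \<longleftrightarrow> x \<in> V0 \<and> y \<in> V0 \<and> E x y" for x y
    have "finite V0" using simple_graph_finite[OF G] by (simp add: V0_def)
    then have F: "simple_graph V0 F"
      using simple_graph_sym[OF G] simple_graph_irrefl[OF G] by (simp add: simple_graph_def F_def)
    have id: "bij_betw (\<lambda>x. x) V0 V0" by (simp add: bij_betw_def)
    have "kcliques V0 F 2 = kcliques V0 E 2"
      by (rule kcliques_bij[OF id]) (simp add: F_def)
    moreover have "degree V0 F v = degree V0 E v" if "v \<in> V0" for v
      using that by (intro degree_bij[OF id]) (simp add: F_def)
    ultimately have "2 * e = real (\<Sum>v\<in>V0. degree V0 E v)"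
      using sum_degree_eq[OF F] by (simp add: e_def)
    also have "\<dots> = (\<Sum>v\<in>V0. n - real p * m)" using reg by simp
    finally show ?thesis using V0 by (simp add: mult.commute)
  qed
  define U where "U j = {v \<in> V. part v \<le> j}" for j
  \<comment> \<open>\<open>U j\<close> is the join of \<open>V0\<close> with \<open>j\<close>
    independent classes. As \<open>V0\<close> has no triangle, a clique of \<open>U j\<close> has at
    most \<open>j + 2\<close> vertices, and one of that size consists of an edge of
    \<open>V0\<close> and one vertex from each class.\<close>
  have main: "real (card (U j)) = n - (real p - 1) * m + real j * m
      \<and> real (kcliques (U j) E 2) = e + real j * m * (n - (real p - 1) * m) + real j * (real j - 1) / 2 * m^2
      \<and> real (kcliques (U j) E (j + 2)) = e * m ^ j \<and> kcliques (U j) E (j + 3) = 0"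
    if "j < p" for j
    using that
  proof (induction j)
    case 0
    have "U 0 = V0" by (auto simp: U_def V0_def)
    then show ?case using V0 triangle_free by (simp add: e_def numeral_2_eq_2)
  next
    case (Suc j)
    let ?B = "{v \<in> V. part v = Suc j}"
    have fin: "finite (U j)" "finite ?B" using simple_graph_finite[OF G] by (simp_all add: U_def)
    have disj: "U j \<inter> ?B = {}" by (auto simp: U_def)
    have un: "U (Suc j) = U j \<union> ?B" by (auto simp: U_def)
    have B: "real (card ?B) = m" using parts Suc.prems by simp
    have step: "real (kcliques (U (Suc j)) E (Suc r))
        = real (kcliques (U j) E (Suc r)) + m * real (kcliques (U j) E r)" for r
    proof -
      have "kcliques (U j \<union> ?B) E (Suc r) = kcliques (U j) E (Suc r) + card ?B * kcliques (U j) E r"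
      proof (rule kcliques_join_independent[OF fin disj])
        fix u b assume "u \<in> U j" "b \<in> ?B"
        then show "E u b \<and> E b u" using complete[of u b] complete[of b u] by (auto simp: U_def)
      next
        fix a b assume "a \<in> ?B" "b \<in> ?B"
        then show "\<not> E a b" using indep[of a b] by auto
      qed
      then show ?thesis unfolding un B[symmetric] by simp
    qed
    have IH: "real (card (U j)) = n - (real p - 1) * m + real j * m"
      "real (kcliques (U j) E 2) = e + real j * m * (n - (real p - 1) * m) + real j * (real j - 1) / 2 * m^2"
      "real (kcliques (U j) E (j + 2)) = e * m ^ j" "kcliques (U j) E (j + 3) = 0"
      using Suc.IH Suc.prems by simp_all
    have zero: "kcliques (U j) E (j + 4) = 0"
    proof -
      have "cliques (U j) E (j + 3) = {}"
        using IH(4) finite_cliques[OF fin(1)] by (simp add: kcliques_eq_card)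
      moreover have "\<exists>T. T \<in> cliques (U j) E (j + 3)" if "S \<in> cliques (U j) E (j + 4)" for S
      proof -
        have "S \<noteq> {}" using that by (auto simp: cliques_def)
        then obtain u where "u \<in> S" by blast
        moreover have "finite S" using that fin(1) finite_subset by (auto simp: cliques_def)
        ultimately have "S - {u} \<in> cliques (U j) E (j + 3)" using that by (auto simp: cliques_def)
        then show ?thesis by blast
      qed
      ultimately have "cliques (U j) E (j + 4) = {}" by blast
      then show ?thesis by (simp add: kcliques_eq_card)
    qed
    have "real (card (U (Suc j))) = n - (real p - 1) * m + real (Suc j) * m"
      unfolding un using card_Un_disjoint[OF fin disj] B IH(1) by (simp add: algebra_simps)
    moreover have "real (kcliques (U (Suc j)) E 2)
      = e + real (Suc j) * m * (n - (real p - 1) * m) + real (Suc j) * (real (Suc j) - 1) / 2 * m^2"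
    proof -
      have "real (kcliques (U (Suc j)) E 2) = real (kcliques (U j) E 2) + m * real (card (U j))"
        using step[of 1] kcliques_1[of "U j" E] by (simp add: numeral_2_eq_2)
      then show ?thesis unfolding IH(1,2) by (simp add: field_simps power2_eq_square)
    qed
    moreover have "real (kcliques (U (Suc j)) E (Suc j + 2)) = e * m ^ Suc j"
      using step[of "j + 2"] IH(3,4) by (simp add: numeral_3_eq_3)
    moreover have "real (kcliques (U (Suc j)) E (Suc j + 3)) = 0"
      using step[of "j + 3"] IH(4) zero by (simp add: eval_nat_numeral)
    ultimately show ?case by simp
  qed
  have UV: "U (p - 1) = V" using less by (fastforce simp: U_def)
  have q: "real (p - 1) = real p - 1" using p by simp
  have final: "real (kcliques V E 2) = e + (real p - 1) * m * (n - (real p - 1) * m) + (real p - 1) * (real p - 2) / 2 * m^2"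
    "real (kcliques V E (p - 1 + 2)) = e * m ^ (p - 1)"
    using main[of "p - 1"] p unfolding UV q by simp_all
  \<comment> \<open>At size \<open>p + 1\<close> the binomials \<open>p - 1 choose p + 1\<close> and
    \<open>p - 1 choose p\<close> vanish, so only the last summand of \<open>ref\<close> is
    left.\<close>
  have "p - 1 + 2 = Suc p" "Suc p - 2 = p - 1" using p by simp_all
  then show "real (kcliques V E (Suc p)) = ref (p - 1) n m (Suc p)"
    using final(2) p q by (simp add: ref_def e binomial_eq_0)
  have "real ((p - 1) choose 2) = (real p - 1) * (real p - 2) / 2"
    using choose_Suc_mult[of 1 "p - 1"] q by (simp add: numeral_2_eq_2 mult.commute)
  then show "real (kcliques V E 2) = ref (p - 1) n m 2"
    using final(1) q unfolding ref_def by (simp add: e)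
qed

section \<open>Two lemmas on linear recursions\<close>

text \<open>Each step down settles \<open>z s\<close> first, from both values at
  \<open>Suc s\<close>, and then \<open>x s\<close>, because \<open>x_step\<close> involves
  \<open>z\<close> at the same index.\<close>

lemma backward_nonneg:
  fixes x z a b :: "nat \<Rightarrow> real" and \<epsilon> :: real
  assumes x_top: "0 \<le> x (Suc p)" and z_top: "0 \<le> z (Suc p)" and \<epsilon>: "0 \<le> \<epsilon>"
    and a: "\<And>s. 2 \<le> s \<Longrightarrow> s \<le> p \<Longrightarrow> 0 < a s" and b: "\<And>s. 2 \<le> s \<Longrightarrow> s \<le> p \<Longrightarrow> 0 < b s"
    and z_step: "\<And>s. 2 \<le> s \<Longrightarrow> s \<le> p \<Longrightarrow> (real s - 1) * z (Suc s) + \<epsilon> * x (Suc s) \<le> a s * z s"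
    and x_step: "\<And>s. 2 \<le> s \<Longrightarrow> s \<le> p \<Longrightarrow> z s + real (Suc s) * x (Suc s) \<le> b s * x s"
    and s: "2 \<le> s" "s \<le> Suc p"
  shows "0 \<le> z s \<and> 0 \<le> x s"
  using s(2) s(1)
proof (induction s rule: inc_induct)
  case base
  then show ?case using x_top z_top by simp
next
  case (step s)
  then have IH: "0 \<le> z (Suc s)" "0 \<le> x (Suc s)" and s: "2 \<le> s" "s \<le> p" by auto
  have "0 \<le> (real s - 1) * z (Suc s) + \<epsilon> * x (Suc s)"
    using IH s \<epsilon> by simp
  then have "0 \<le> a s * z s" using z_step[OF s] by linarith
  then have z: "0 \<le> z s" using a[OF s] by (simp add: zero_le_mult_iff)
  have "0 \<le> z s + real (Suc s) * x (Suc s)" using z IH by simp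
  then have "0 \<le> b s * x s" using x_step[OF s] by linarith
  then have "0 \<le> x s" using b[OF s] by (simp add: zero_le_mult_iff)
  then show ?case using z by simp
qed

text \<open>The same recursions run upwards. All terms on the left are nonnegative, so a vanishing
  right side makes each of them vanish: first \<open>x (Suc s)\<close>, then
  \<open>z (Suc s)\<close>, whose coefficient \<open>s - 1\<close> is positive.\<close>

lemma forward_zero:
  fixes x z a b :: "nat \<Rightarrow> real" and \<epsilon> :: real
  assumes nonneg: "\<And>s. 2 \<le> s \<Longrightarrow> s \<le> Suc p \<Longrightarrow> 0 \<le> z s \<and> 0 \<le> x s" and \<epsilon>: "0 \<le> \<epsilon>"
    and z_step: "\<And>s. 2 \<le> s \<Longrightarrow> s \<le> p \<Longrightarrow> (real s - 1) * z (Suc s) + \<epsilon> * x (Suc s) \<le> a s * z s"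
    and x_step: "\<And>s. 2 \<le> s \<Longrightarrow> s \<le> p \<Longrightarrow> z s + real (Suc s) * x (Suc s) \<le> b s * x s"
    and start: "x 2 = 0" and p: "2 \<le> p" and s: "2 \<le> s" "s \<le> Suc p"
  shows "z s = 0 \<and> x s = 0"
  using s
proof (induction s rule: dec_induct)
  case base
  have "z 2 + 3 * x 3 \<le> 0" using x_step[of 2] start p by (simp add: numeral_3_eq_3)
  then show ?case using nonneg[of 2] nonneg[of 3] start p by simp
next
  case (step s)
  then have s: "2 \<le> s" "s \<le> p" and IH: "z s = 0" "x s = 0" by auto
  have nn: "0 \<le> z (Suc s)" "0 \<le> x (Suc s)" using nonneg[of "Suc s"] s by auto
  have "real (Suc s) * x (Suc s) \<le> 0" using x_step[OF s] IH by simp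
  then have x0: "x (Suc s) = 0" using nn by (simp add: mult_le_0_iff)
  have "(real s - 1) * z (Suc s) \<le> 0" using z_step[OF s] IH x0 by simp
  then have "z (Suc s) = 0" using nn s by (simp add: mult_le_0_iff)
  then show ?case using x0 by simp
qed

section \<open>Truncated codegrees\<close>

text \<open>\<open>m\<close> stands for \<open>\<beta> n\<close>, and the last two assumptions say
  that \<open>p\<close> is the ceiling of \<open>n / m\<close> minus 1.\<close>

locale dense_graph =
  fixes V :: "'a set" and E :: "'a \<Rightarrow> 'a \<Rightarrow> bool" and p :: nat and m :: real
  assumes simple: "simple_graph V E"
    and degree_ge: "v \<in> V \<Longrightarrow> real (card V) - m \<le> real (degree V E v)"
    and p_ge: "2 \<le> p"
    and p_lower: "real p * m < real (card V)"
    and p_upper: "real (card V) \<le> (real p + 1) * m"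
begin

abbreviation "n \<equiv> real (card V)"
abbreviation "K \<equiv> cliques V E"
abbreviation "k r \<equiv> real (kcliques V E r)"

definition codeg :: "'a set \<Rightarrow> real" where
  "codeg A = real (card (common V E A))"

text \<open>The codegree in an extremal graph of an s-clique with two vertices in \<open>V0\<close>:
  it meets \<open>s - 2\<close> of the \<open>p - 1\<close> independent classes, and its common
  neighbours are the remaining \<open>p + 1 - s\<close> classes.\<close>

definition cap :: "nat \<Rightarrow> real" where
  "cap s = (real p + 1 - real s) * m"

definition trunc :: "'a set \<Rightarrow> real" where
  "trunc A = min (codeg A) (cap (card A))"

lemma finite_V: "finite V" using simple by (simp add: simple_graph_def)

lemma m_pos: "0 < m" using p_lower p_upper by (simp add: algebra_simps)

lemma nonnbrs_le: "v \<in> V \<Longrightarrow> real (card (nonnbrs V E v)) \<le> m"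
  using degree_ge[of v] card_nonnbrs[OF simple, of v] by simp

lemma finite_clique: "S \<in> K s \<Longrightarrow> finite S"
  using finite_V by (auto simp: cliques_def intro: finite_subset)

text \<open>Each member of \<open>A\<close> excludes at most \<open>m\<close> vertices.\<close>

lemma codeg_ge:
  assumes "A \<subseteq> V"
  shows "n - real (card A) * m \<le> codeg A"
proof -
  have fin: "finite A" using assms finite_V finite_subset by blast
  have "V \<subseteq> common V E A \<union> (\<Union>u\<in>A. nonnbrs V E u)"
    by (auto simp: common_def nonnbrs_def)
  moreover have "finite (common V E A \<union> (\<Union>u\<in>A. nonnbrs V E u))"
    using finite_V fin by (auto simp: common_def nonnbrs_def)
  ultimately have "card V \<le> card (common V E A \<union> (\<Union>u\<in>A. nonnbrs V E u))"
    by (rule card_mono[rotated])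
  also have "\<dots> \<le> card (common V E A) + card (\<Union>u\<in>A. nonnbrs V E u)"
    by (rule card_Un_le)
  also have "\<dots> \<le> card (common V E A) + (\<Sum>u\<in>A. card (nonnbrs V E u))"
    using card_UN_le[OF fin] by simp
  finally have "n \<le> codeg A + (\<Sum>u\<in>A. real (card (nonnbrs V E u)))"
    unfolding codeg_def by (simp flip: of_nat_sum of_nat_add)
  also have "(\<Sum>u\<in>A. real (card (nonnbrs V E u))) \<le> real (card A) * m"
    using assms by (intro sum_bounded_above nonnbrs_le) auto
  finally show ?thesis by simp
qed

lemma codeg_remove_le:
  assumes "S \<subseteq> V" "u \<in> S"
  shows "codeg (S - {u}) \<le> codeg S + m"
proof -
  have "common V E (S - {u}) \<subseteq> common V E S \<union> nonnbrs V E u"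
    by (auto simp: common_def nonnbrs_def)
  moreover have "finite (common V E S \<union> nonnbrs V E u)"
    using finite_V by (auto simp: common_def nonnbrs_def)
  ultimately have "card (common V E (S - {u})) \<le> card (common V E S \<union> nonnbrs V E u)"
    by (rule card_mono[rotated])
  also have "\<dots> \<le> card (common V E S) + card (nonnbrs V E u)"
    by (rule card_Un_le)
  finally have "card (common V E (S - {u})) \<le> card (common V E S) + card (nonnbrs V E u)" .
  moreover have "real (card (nonnbrs V E u)) \<le> m" using assms by (intro nonnbrs_le) auto
  ultimately show ?thesis by (simp add: codeg_def)
qed

lemma base_le_cap: "n - real s * m \<le> cap s"
  using p_upper by (simp add: cap_def algebra_simps)

lemma sum_codeg_facets_ge:
  assumes S: "S \<in> K (Suc s)" and s: "1 \<le> s"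
  shows "2 * n - real (Suc s) * m + (real s - 1) * codeg S \<le> (\<Sum>u\<in>S. codeg (S - {u}))"
proof -
  have "S \<subseteq> V" "card S = Suc s" using S by (auto simp: cliques_def)
  then have "2 * n + (real s - 1) * codeg S
      \<le> (\<Sum>u\<in>S. codeg (S - {u})) + (\<Sum>u\<in>S. real (card (nonnbrs V E u)))"
    using sum_card_remove_lower_bound[OF simple _ _ s] by (simp add: codeg_def)
  moreover have "(\<Sum>u\<in>S. real (card (nonnbrs V E u))) \<le> real (card S) * m"
    using \<open>S \<subseteq> V\<close> by (intro sum_bounded_above nonnbrs_le) auto
  ultimately show ?thesis using \<open>card S = Suc s\<close> by simp
qed

lemma sum_trunc_facets_ge:
  assumes S: "S \<in> K (Suc s)" and s: "1 \<le> s"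
  shows "2 * n - real (Suc s) * m + (real s - 1) * trunc S \<le> (\<Sum>u\<in>S. trunc (S - {u}))"
proof -
  have SV: "S \<subseteq> V" and cS: "card S = Suc s" using S by (auto simp: cliques_def)
  have fS: "finite S" by (rule finite_clique[OF S])
  have cf: "card (S - {u}) = s" if "u \<in> S" for u using that cS fS by simp
  define H where "H = {u \<in> S. cap s < codeg (S - {u})}"
  have "H \<subseteq> S" by (auto simp: H_def)
  have split: "(\<Sum>u\<in>S. c + d * of_bool (u \<in> H)) = real (Suc s) * c + d * real (card H)" for c d :: real
  proof -
    have "(\<Sum>u\<in>S. of_bool (u \<in> H)) = real (card H)"
      using fS \<open>H \<subseteq> S\<close> by (simp add: of_bool_def sum.If_cases Int_absorb1)
    then show ?thesis using cS by (simp add: sum.distrib sum_distrib_left[symmetric])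
  qed
  have cap_Suc: "cap s = cap (Suc s) + m" by (simp add: cap_def algebra_simps)
  \<comment> \<open>If few facets are truncated, the loss is at most \<open>s - 1\<close> times the loss of \<open>S\<close> itself; if
     many are, the minimum possible value of each facet already suffices.\<close>
  show ?thesis
  proof (cases "card H \<le> s - 1")
    case True
    define \<delta> where "\<delta> = codeg S - trunc S"
    have "0 \<le> \<delta>" by (simp add: \<delta>_def trunc_def)
    \<comment> \<open>Deleting a vertex raises the codegree by at most \<open>m\<close>, which is
      just how much the cap rises. So a truncated facet loses no more than \<open>S\<close>
      does.\<close>
    have pw: "codeg (S - {u}) \<le> trunc (S - {u}) + \<delta> * of_bool (u \<in> H)" if "u \<in> S" for u
      using codeg_remove_le[OF SV that] cap_Suc that
      by (auto simp: H_def trunc_def \<delta>_def cf cS min_def)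
    have "(\<Sum>u\<in>S. codeg (S - {u})) \<le> (\<Sum>u\<in>S. trunc (S - {u}) + \<delta> * of_bool (u \<in> H))"
      by (intro sum_mono pw)
    also have "\<dots> = (\<Sum>u\<in>S. trunc (S - {u})) + \<delta> * real (card H)"
      using split[of 0 \<delta>] by (simp add: sum.distrib)
    also have "\<delta> * real (card H) \<le> \<delta> * (real s - 1)"
      using True s \<open>0 \<le> \<delta>\<close> by (intro mult_left_mono) linarith+
    finally show ?thesis
      using sum_codeg_facets_ge[OF S s] by (simp add: \<delta>_def algebra_simps)
  next
    case False
    \<comment> \<open>Facets in \<open>H\<close> attain the cap and all others have at least
      \<open>n - s m\<close>. With \<open>s - 1\<close> facets at the cap these bounds already add
      up to \<open>2 n - (s + 1) m + (s - 1) cap (s + 1)\<close>.\<close>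
    have pw: "(n - real s * m) + (cap s - (n - real s * m)) * of_bool (u \<in> H) \<le> trunc (S - {u})"
      if "u \<in> S" for u
    proof -
      have "n - real s * m \<le> codeg (S - {u})"
        using codeg_ge[of "S - {u}"] SV by (auto simp: cf[OF that])
      then show ?thesis
        using that base_le_cap[of s] by (simp add: H_def trunc_def cf[OF that])
    qed
    have "real (Suc s) * (n - real s * m) + (cap s - (n - real s * m)) * real (card H)
        \<le> (\<Sum>u\<in>S. trunc (S - {u}))"
      unfolding split[symmetric] by (intro sum_mono pw)
    moreover have "(cap s - (n - real s * m)) * (real s - 1) \<le> (cap s - (n - real s * m)) * real (card H)"
      using False s base_le_cap[of s] by (intro mult_left_mono) linarith+
    moreover have "(real s - 1) * trunc S \<le> (real s - 1) * cap (Suc s)"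
      using s by (intro mult_left_mono) (auto simp: trunc_def cS)
    ultimately show ?thesis by (simp add: cap_def algebra_simps)
  qed
qed

section \<open>The linear recursion\<close>

text \<open>In an extremal graph, for sizes from 2 on, only the cliques counted by
  \<open>ref_light\<close> contribute, each with \<open>(p + 1) m - n\<close>.\<close>

definition W :: "nat \<Rightarrow> real" where
  "W s = (\<Sum>T\<in>K s. cap s - trunc T)"

text \<open>For a clique of size \<open>s\<close> this vanishes exactly if the codegree is
  \<open>n - s m\<close> or at least the cap. In the equality case it confines codegrees to two
  values.\<close>

definition light_slack :: "'a set \<Rightarrow> real" where
  "light_slack T = (codeg T - (n - real (card T) * m)) * (cap (card T) - trunc T)"

definition facet_slack :: "nat \<Rightarrow> 'a set \<Rightarrow> real" where
  "facet_slack s S = (\<Sum>u\<in>S. trunc (S - {u})) - (2 * n - real (Suc s) * m + (real s - 1) * trunc S)"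

lemma light_slack_nonneg: "T \<in> K s \<Longrightarrow> 0 \<le> light_slack T"
  unfolding light_slack_def
  by (intro mult_nonneg_nonneg) (use codeg_ge[of T] in \<open>auto simp: trunc_def cliques_def\<close>)

lemma facet_slack_nonneg: "S \<in> K (Suc s) \<Longrightarrow> 1 \<le> s \<Longrightarrow> 0 \<le> facet_slack s S"
  using sum_trunc_facets_ge[of S s] by (simp add: facet_slack_def)

text \<open>The quantity \<open>cap s - trunc T\<close>, summed over all pairs of an s-clique
  \<open>T\<close> and a common neighbour, is counted by s-cliques and by (s + 1)-cliques. The
  slacks are kept explicit so that equality in the theorem forces each of them to vanish.\<close>

lemma W_recursion:
  "(real s - 1) * W (Suc s) + 2 * ((real p + 1) * m - n) * k (Suc s) - (n - real s * m) * W s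
     = (\<Sum>T\<in>K s. light_slack T) + (\<Sum>S\<in>K (Suc s). facet_slack s S)"
proof -
  have "(\<Sum>T\<in>K s. light_slack T)
      = (\<Sum>T\<in>K s. codeg T * (cap s - trunc T) - (n - real s * m) * (cap s - trunc T))"
    by (intro sum.cong refl) (auto simp: light_slack_def cliques_def left_diff_distrib)
  also have "\<dots> = (\<Sum>T\<in>K s. codeg T * (cap s - trunc T)) - (n - real s * m) * W s"
    unfolding W_def sum_distrib_left by (rule sum_subtractf)
  also have "(\<Sum>T\<in>K s. codeg T * (cap s - trunc T))
      = (\<Sum>S\<in>K (Suc s). \<Sum>u\<in>S. cap s - trunc (S - {u}))"
    using sum_over_facets[OF simple, of "\<lambda>T. cap s - trunc T" s] by (simp add: codeg_def)
  \<comment> \<open>The constant is what remains of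
    \<open>(s + 1) cap s - (2 n - (s + 1) m) - (s - 1) cap (s + 1)\<close>.\<close>
  also have "\<dots> = (\<Sum>S\<in>K (Suc s). (real s - 1) * (cap (Suc s) - trunc S)
                    + 2 * ((real p + 1) * m - n) - facet_slack s S)"
  proof (intro sum.cong refl)
    fix S assume "S \<in> K (Suc s)"
    then have "(\<Sum>u\<in>S. cap s - trunc (S - {u})) = real (Suc s) * cap s - (\<Sum>u\<in>S. trunc (S - {u}))"
      by (simp add: sum_subtractf cliques_def)
    then show "(\<Sum>u\<in>S. cap s - trunc (S - {u}))
        = (real s - 1) * (cap (Suc s) - trunc S) + 2 * ((real p + 1) * m - n) - facet_slack s S"
      by (simp add: facet_slack_def cap_def algebra_simps)
  qed
  also have "\<dots> = (real s - 1) * W (Suc s) + 2 * ((real p + 1) * m - n) * k (Suc s)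
                    - (\<Sum>S\<in>K (Suc s). facet_slack s S)"
    unfolding W_def kcliques_eq_card
    by (simp add: sum_subtractf sum.distrib flip: sum_distrib_left)
  finally show ?thesis by simp
qed

lemma W_step:
  assumes "1 \<le> s"
  shows "(n - real s * m) * W s \<le> (real s - 1) * W (Suc s) + 2 * ((real p + 1) * m - n) * k (Suc s)"
proof -
  have "0 \<le> (\<Sum>T\<in>K s. light_slack T) + (\<Sum>S\<in>K (Suc s). facet_slack s S)"
    using assms by (intro add_nonneg_nonneg sum_nonneg light_slack_nonneg facet_slack_nonneg) auto
  then show ?thesis using W_recursion[of s] by linarith
qed

lemma excess_eq:
  "real (Suc s) * k (Suc s) - (cap s * k s - W s) = (\<Sum>T\<in>K s. codeg T - trunc T)"
  using sum_card_common[OF simple, of s]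
  by (simp add: W_def codeg_def sum_subtractf kcliques_eq_card)

lemma excess_nonneg: "cap s * k s - W s \<le> real (Suc s) * k (Suc s)"
proof -
  have "0 \<le> (\<Sum>T\<in>K s. codeg T - trunc T)"
    by (intro sum_nonneg) (auto simp: trunc_def)
  then show ?thesis using excess_eq[of s] by linarith
qed

text \<open>\<open>cap (Suc p)\<close> is zero, so truncation hides whether a clique of size
  \<open>p + 1\<close> extends. This gives the recursion its starting value.\<close>

lemma W_top: "W (Suc p) = 0"
  unfolding W_def by (intro sum.neutral) (auto simp: trunc_def cap_def cliques_def codeg_def)

section \<open>Comparison with the scaled extremal counts\<close>

abbreviation "R \<equiv> ref (p - 1) n m"
abbreviation "L \<equiv> ref_light (p - 1) n m"
abbreviation "\<epsilon> \<equiv> 2 * ((real p + 1) * m - n)"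

text \<open>The left side of the theorem's inequality, used as the scale at which graph and extremal
  counts agree at size \<open>p + 1\<close>.\<close>

definition top_density :: real where
  "top_density = k (Suc p) / R (Suc p)"

text \<open>Nonnegativity of \<open>x_gap t\<close> is the inequality of the theorem.
  \<open>z_gap\<close> does the same for \<open>W\<close> and is carried along because the
  recursions couple the two.\<close>

definition x_gap :: "nat \<Rightarrow> real" where
  "x_gap s = top_density * R s - k s"

definition z_gap :: "nat \<Rightarrow> real" where
  "z_gap s = top_density * (((real p + 1) * m - n) * L s) - W s"

lemma real_p_minus_1: "real (p - 1) = real p - 1"
  using p_ge by simp

text \<open>The last summand is already positive, since \<open>s - 2 \<le> p - 1\<close> and
  \<open>p m < n\<close>; the other two are nonnegative.\<close>

lemma R_pos:
  assumes "2 \<le> s" "s \<le> Suc p"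
  shows "0 < R s"
proof -
  have a: "0 < n - real p * m" "0 < n - (real p - 1) * m"
    using p_lower m_pos by (simp_all add: left_diff_distrib)
  have "0 < (p - 1) choose (s - 2)"
    using assms p_ge by (intro zero_less_binomial) linarith
  then have "0 < 1/2 * real ((p - 1) choose (s - 2)) * (n - real p * m) * (n - (real p - 1) * m) * m ^ (s - 2)"
    using a m_pos by (intro mult_pos_pos) auto
  moreover have "0 \<le> real ((p - 1) choose s) * m ^ s"
    "0 \<le> real ((p - 1) choose (s - 1)) * (n - (real p - 1) * m) * m ^ (s - 1)"
    using a m_pos by (auto intro!: mult_nonneg_nonneg)
  ultimately show ?thesis unfolding ref_def real_p_minus_1 by simp
qed

lemma R_gap: "2 \<le> s \<Longrightarrow> cap s * R s = ((real p + 1) * m - n) * L s + real (Suc s) * R (Suc s)"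
  using ref_gap[of s "p - 1" m n] p_ge by (simp add: cap_def algebra_simps)

lemma L_step: "2 \<le> s \<Longrightarrow> (n - real s * m) * L s = (real s - 1) * L (Suc s) + 2 * R (Suc s)"
  by (rule ref_light_step)

lemma \<epsilon>_nonneg: "0 \<le> \<epsilon>" using p_upper by simp

text \<open>The first equation is the choice of scale. For the second, both \<open>W\<close> and
  \<open>L\<close> vanish at \<open>p + 1\<close>, the latter because its binomials do.\<close>

lemma gap_top: "x_gap (Suc p) = 0" "z_gap (Suc p) = 0"
  using R_pos[of "Suc p"] p_ge
  by (simp_all add: x_gap_def z_gap_def top_density_def W_top ref_light_def binomial_eq_0)

lemma base_pos:
  assumes "s \<le> p"
  shows "0 < n - real s * m"
proof -
  have "real s * m \<le> real p * m" using assms m_pos by (intro mult_right_mono) auto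
  then show ?thesis using p_lower by linarith
qed

lemma cap_pos: "s \<le> p \<Longrightarrow> 0 < cap s"
  using m_pos by (simp add: cap_def)

text \<open>\<open>L_step\<close> cancels the scaled extremal terms, so exactly the slack of
  \<open>W_step\<close> is left.\<close>

lemma z_gap_identity:
  assumes "2 \<le> s"
  shows "(n - real s * m) * z_gap s - ((real s - 1) * z_gap (Suc s) + \<epsilon> * x_gap (Suc s))
    = (real s - 1) * W (Suc s) + \<epsilon> * k (Suc s) - (n - real s * m) * W s"
proof -
  have "(n - real s * m) * z_gap s
      = top_density * ((real p + 1) * m - n) * ((n - real s * m) * L s) - (n - real s * m) * W s"
    by (simp add: z_gap_def right_diff_distrib)
  also have "(n - real s * m) * L s = (real s - 1) * L (Suc s) + 2 * R (Suc s)"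
    by (rule L_step[OF assms])
  finally show ?thesis by (simp add: z_gap_def x_gap_def algebra_simps)
qed

text \<open>\<open>R_gap\<close> cancels the extremal terms and leaves the total loss by truncation
  from \<open>excess_eq\<close>.\<close>

lemma x_gap_identity:
  assumes "2 \<le> s"
  shows "cap s * x_gap s - (z_gap s + real (Suc s) * x_gap (Suc s))
    = real (Suc s) * k (Suc s) - (cap s * k s - W s)"
proof -
  have "cap s * x_gap s = top_density * (cap s * R s) - cap s * k s"
    by (simp add: x_gap_def right_diff_distrib)
  also have "cap s * R s = ((real p + 1) * m - n) * L s + real (Suc s) * R (Suc s)"
    by (rule R_gap[OF assms])
  finally show ?thesis by (simp add: z_gap_def x_gap_def algebra_simps)
qed

lemma z_gap_step:
  "2 \<le> s \<Longrightarrow> (real s - 1) * z_gap (Suc s) + \<epsilon> * x_gap (Suc s) \<le> (n - real s * m) * z_gap s"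
  using z_gap_identity[of s] W_step[of s] by linarith

lemma x_gap_step: "2 \<le> s \<Longrightarrow> z_gap s + real (Suc s) * x_gap (Suc s) \<le> cap s * x_gap s"
  using x_gap_identity[of s] excess_nonneg[of s] by linarith

lemma gap_nonneg:
  assumes "2 \<le> s" "s \<le> Suc p"
  shows "0 \<le> z_gap s \<and> 0 \<le> x_gap s"
proof (rule backward_nonneg[where \<epsilon> = \<epsilon> and a = "\<lambda>s. n - real s * m" and b = cap])
  show "0 \<le> x_gap (Suc p)" "0 \<le> z_gap (Suc p)" by (simp_all add: gap_top)
qed (use assms in \<open>simp_all only: \<epsilon>_nonneg base_pos cap_pos z_gap_step x_gap_step\<close>)

lemma clique_density: "2 \<le> s \<Longrightarrow> s \<le> Suc p \<Longrightarrow> k s \<le> top_density * R s"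
  using gap_nonneg[of s] by (simp add: x_gap_def)

section \<open>The equality case\<close>

context
  assumes tight: "k 2 = top_density * R 2"
begin

lemma gap_zero:
  assumes "2 \<le> s" "s \<le> Suc p"
  shows "z_gap s = 0 \<and> x_gap s = 0"
proof (rule forward_zero[where \<epsilon> = \<epsilon> and a = "\<lambda>s. n - real s * m" and b = cap])
  show "x_gap 2 = 0" using tight by (simp add: x_gap_def)
qed (use assms in \<open>simp_all only: gap_nonneg p_ge \<epsilon>_nonneg z_gap_step x_gap_step\<close>)

text \<open>With all gaps zero, \<open>z_gap_identity\<close> and \<open>W_recursion\<close> make
  the sum of the nonnegative slacks zero.\<close>

lemma slack_zero:
  assumes s: "2 \<le> s" "s \<le> p"
  shows "T \<in> K s \<Longrightarrow> light_slack T = 0" "S \<in> K (Suc s) \<Longrightarrow> facet_slack s S = 0"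
proof -
  have "(real s - 1) * W (Suc s) + \<epsilon> * k (Suc s) - (n - real s * m) * W s = 0"
    using z_gap_identity[OF s(1)] gap_zero[of s] gap_zero[of "Suc s"] s by simp
  then have sum0: "(\<Sum>T\<in>K s. light_slack T) + (\<Sum>S\<in>K (Suc s). facet_slack s S) = 0"
    using W_recursion[of s] by linarith
  have nn: "\<And>T. T \<in> K s \<Longrightarrow> 0 \<le> light_slack T" "\<And>S. S \<in> K (Suc s) \<Longrightarrow> 0 \<le> facet_slack s S"
    using light_slack_nonneg facet_slack_nonneg s by auto
  then have "0 \<le> (\<Sum>T\<in>K s. light_slack T)" "0 \<le> (\<Sum>S\<in>K (Suc s). facet_slack s S)"
    by (auto intro!: sum_nonneg)
  then have "(\<Sum>T\<in>K s. light_slack T) = 0" "(\<Sum>S\<in>K (Suc s). facet_slack s S) = 0"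
    using sum0 by linarith+
  then show "T \<in> K s \<Longrightarrow> light_slack T = 0" "S \<in> K (Suc s) \<Longrightarrow> facet_slack s S = 0"
    using nn finite_cliques[OF finite_V] by (auto simp: sum_nonneg_eq_0_iff)
qed

lemma codeg_edge:
  assumes "T \<in> K 2"
  shows "codeg T = trunc T"
proof -
  have "(\<Sum>T\<in>K 2. codeg T - trunc T) = 0"
    using excess_eq[of 2] x_gap_identity[of 2] gap_zero[of 2] gap_zero[of "Suc 2"] p_ge by simp
  moreover have "\<And>T. 0 \<le> codeg T - trunc T" by (simp add: trunc_def)
  ultimately have "\<forall>T\<in>K 2. codeg T - trunc T = 0"
    using finite_cliques[OF finite_V] by (subst (asm) sum_nonneg_eq_0_iff) auto
  then show ?thesis using assms by simp
qed

text \<open>If no facet of \<open>S\<close> is truncated, the tight bound for \<open>trunc\<close>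
  and the general bound for \<open>codeg\<close> have the same facet sum, whence
  \<open>codeg S \<le> trunc S\<close>. The induction reaches size \<open>p + 1\<close>, where the
  cap is zero and (p + 2)-cliques are thereby excluded.\<close>

lemma codeg_eq_trunc:
  assumes "2 \<le> s" "s \<le> Suc p" "S \<in> K s"
  shows "codeg S = trunc S"
  using assms
proof (induction s arbitrary: S rule: dec_induct)
  case base
  then show ?case using codeg_edge by simp
next
  case (step s)
  then have s: "2 \<le> s" "s \<le> p" and S: "S \<in> K (Suc s)" by auto
  have "(\<Sum>u\<in>S. codeg (S - {u})) = (\<Sum>u\<in>S. trunc (S - {u}))"
    using step.IH remove_from_clique(1)[OF simple S] s by (intro sum.cong) auto
  then have "(real s - 1) * codeg S \<le> (real s - 1) * trunc S"
    using slack_zero(2)[OF s S] sum_codeg_facets_ge[OF S] s by (simp add: facet_slack_def)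
  then have "codeg S \<le> trunc S" using s by simp
  then show ?case by (simp add: trunc_def)
qed

section \<open>Cliques of size p + 1 and the partition they determine\<close>

lemma top_clique_maximal:
  assumes "S \<in> K (Suc p)"
  shows "common V E S = {}"
proof -
  have "codeg S = 0"
    using codeg_eq_trunc[of "Suc p" S] assms p_ge by (simp add: trunc_def cap_def cliques_def codeg_def)
  moreover have "finite (common V E S)" using finite_V by (simp add: common_def)
  ultimately show ?thesis by (simp add: codeg_def)
qed

lemma sum_codeg_top:
  assumes S: "S \<in> K (Suc p)"
  shows "(\<Sum>u\<in>S. codeg (S - {u})) = 2 * n - real (Suc p) * m"
proof -
  have "(\<Sum>u\<in>S. codeg (S - {u})) = (\<Sum>u\<in>S. trunc (S - {u}))"
    using codeg_eq_trunc[of p] remove_from_clique(1)[OF simple S] p_ge by (intro sum.cong) auto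
  moreover have "trunc S = 0"
    using codeg_eq_trunc[of "Suc p" S] top_clique_maximal[OF S] S p_ge by (simp add: codeg_def)
  ultimately show ?thesis
    using slack_zero(2)[of p S] S p_ge by (simp add: facet_slack_def)
qed

text \<open>In \<open>sum_card_remove_lower_bound\<close> the codegrees of the facets add up to
  \<open>2 n - (p + 1) m\<close>, which leaves at least \<open>(p + 1) m\<close> for
  \<open>p + 1\<close> sets of at most \<open>m\<close> non-neighbours each.\<close>

lemma top_clique_nonnbrs:
  assumes S: "S \<in> K (Suc p)" and u: "u \<in> S"
  shows "real (card (nonnbrs V E u)) = m"
proof -
  have SV: "S \<subseteq> V" and cS: "card S = Suc p" using S by (auto simp: cliques_def)
  have le: "real (card (nonnbrs V E w)) \<le> m" if "w \<in> S" for w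
    using that SV by (intro nonnbrs_le) auto
  have "2 * n \<le> (\<Sum>u\<in>S. codeg (S - {u})) + (\<Sum>u\<in>S. real (card (nonnbrs V E u)))"
    using sum_card_remove_lower_bound[OF simple SV cS] p_ge top_clique_maximal[OF S]
    by (simp add: codeg_def)
  then have "(\<Sum>u\<in>S. m - real (card (nonnbrs V E u))) \<le> 0"
    using sum_codeg_top[OF S] cS by (simp add: sum_subtractf)
  moreover have "0 \<le> (\<Sum>u\<in>S. m - real (card (nonnbrs V E u)))"
    using le by (intro sum_nonneg) auto
  ultimately have "\<forall>u\<in>S. m - real (card (nonnbrs V E u)) = 0"
    using le finite_clique[OF S] by (subst sum_nonneg_eq_0_iff[symmetric]) auto
  then show ?thesis using u by simp
qed

text \<open>Greedy extension: a clique of size \<open>s \<le> p\<close> has at least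
  \<open>n - s m > 0\<close> common neighbours. It carries the count of non-neighbours over to every
  vertex, so the graph is regular.\<close>

lemma ex_top_clique:
  assumes "v \<in> V"
  shows "\<exists>S\<in>K (Suc p). v \<in> S"
proof -
  have "\<exists>S\<in>K s. v \<in> S" if "1 \<le> s" "s \<le> Suc p" for s
    using that
  proof (induction s rule: dec_induct)
    case base
    have "{v} \<in> K 1" using assms by (simp add: cliques_def)
    then show ?case by blast
  next
    case (step s)
    then obtain S where S: "S \<in> K s" "v \<in> S" by auto
    then have "0 < codeg S"
      using codeg_ge[of S] base_pos[of s] step.prems by (auto simp: cliques_def)
    then obtain w where "w \<in> common V E S" unfolding codeg_def by fastforce
    then show ?case using insert_common_in_cliques(1)[OF simple S(1)] S(2) by blast
  qed
  then show ?thesis using p_ge by simp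
qed

lemma nonnbrs_eq: "v \<in> V \<Longrightarrow> real (card (nonnbrs V E v)) = m"
  using ex_top_clique top_clique_nonnbrs by blast

text \<open>Vanishing \<open>light_slack\<close> leaves each facet the codegree
  \<open>n - p m\<close> or \<open>cap p = m\<close>. Their sum
  \<open>2 (n - p m) + (p - 1) m\<close> forces exactly \<open>p - 1\<close> facets with value
  \<open>m\<close>, unless the two values coincide and all facets have it.\<close>

lemma heavy_facets:
  assumes S: "S \<in> K (Suc p)"
  shows "p - 1 \<le> card {u \<in> S. codeg (S - {u}) = m}"
proof -
  define H where "H = {u \<in> S. codeg (S - {u}) = m}"
  have fS: "finite S" and cS: "card S = Suc p"
    using S finite_clique[OF S] by (auto simp: cliques_def)
  have two: "codeg (S - {u}) = n - real p * m \<or> codeg (S - {u}) = m" if "u \<in> S" for u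
  proof -
    have f: "S - {u} \<in> K p" by (rule remove_from_clique(1)[OF simple S that])
    then have "card (S - {u}) = p" by (simp add: cliques_def)
    then show ?thesis
      using slack_zero(1)[of p, OF _ _ f] codeg_eq_trunc[of p, OF _ _ f] p_ge
      by (auto simp: light_slack_def cap_def)
  qed
  show ?thesis
  proof (cases "n - real p * m = m")
    case True
    then have "{u \<in> S. codeg (S - {u}) = m} = S" using two by auto
    then show ?thesis using cS by simp
  next
    case False
    have "(\<Sum>u\<in>S. codeg (S - {u})) = (\<Sum>u\<in>S. (n - real p * m) + (m - (n - real p * m)) * of_bool (u \<in> H))"
      using two by (intro sum.cong) (auto simp: H_def)
    also have "\<dots> = real (Suc p) * (n - real p * m) + (m - (n - real p * m)) * (\<Sum>u\<in>S. of_bool (u \<in> H))"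
      using cS by (simp add: sum.distrib sum_distrib_left)
    also have "(\<Sum>u\<in>S. of_bool (u \<in> H)) = real (card H)"
      using fS by (simp add: of_bool_def sum.If_cases H_def Int_def)
    finally have "(m - (n - real p * m)) * (real (card H) - (real p - 1)) = 0"
      using sum_codeg_top[OF S] by (simp add: algebra_simps)
    then have "real (card H) = real p - 1" using False by simp
    then show ?thesis by (simp add: H_def)
  qed
qed

text \<open>The common neighbourhoods of \<open>p - 1\<close> heavy facets of one (p + 1)-clique are
  the independent classes, and \<open>V0\<close> is the rest.\<close>

lemma extremal_partition:
  obtains part :: "'a \<Rightarrow> nat" where
    "\<And>v. v \<in> V \<Longrightarrow> part v < p"
    "\<And>i. i \<in> {1..<p} \<Longrightarrow> real (card {v \<in> V. part v = i}) = m"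
    "real (card {v \<in> V. part v = 0}) = n - (real p - 1) * m"
    "\<And>x y. x \<in> V \<Longrightarrow> y \<in> V \<Longrightarrow> part x \<noteq> part y \<Longrightarrow> E x y"
    "\<And>x y. x \<in> V \<Longrightarrow> y \<in> V \<Longrightarrow> part x = part y \<Longrightarrow> 1 \<le> part x \<Longrightarrow> \<not> E x y"
    "\<And>v. v \<in> V \<Longrightarrow> part v = 0 \<Longrightarrow> real (degree {v \<in> V. part v = 0} E v) = n - real p * m"
    "kcliques {v \<in> V. part v = 0} E 3 = 0"
proof -
  have "0 \<le> real p * m" using m_pos by simp
  then have "V \<noteq> {}" using p_lower by auto
  then obtain S where S: "S \<in> K (Suc p)" using ex_top_clique by blast
  have SV: "S \<subseteq> V" and fS: "finite S" using S finite_clique[OF S] by (auto simp: cliques_def)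
  obtain H where H: "H \<subseteq> {u \<in> S. codeg (S - {u}) = m}" "card H = p - 1"
    using heavy_facets[OF S] by (meson obtain_subset_with_card_n)
  have "finite H" using H fS finite_subset by fastforce
  then obtain f where f: "bij_betw f {1..<p} H"
    using finite_same_card_bij[of "{1..<p}" H] H by auto
  have fH: "f i \<in> S" "codeg (S - {f i}) = m" if "i \<in> {1..<p}" for i
  proof -
    have "f i \<in> H" using f that by (auto simp: bij_betw_def)
    then show "f i \<in> S" "codeg (S - {f i}) = m" using H(1) by auto
  qed
  define B where "B i = common V E (S - {f i})" for i
  have BV: "B i \<subseteq> V" for i by (auto simp: B_def common_def)
  have B_finite: "finite (B i)" for i using BV finite_V finite_subset by blast
  have B_card: "real (card (B i)) = m" if "i \<in> {1..<p}" for i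
    using fH(2)[OF that] by (simp add: B_def codeg_def)
  have B_self: "f i \<in> B i" if "i \<in> {1..<p}" for i
    using remove_from_clique(2)[OF simple S fH(1)[OF that]] by (simp add: B_def)
  \<comment> \<open>Exchanging \<open>f i\<close> for \<open>x\<close> in \<open>S\<close> gives
    another (p + 1)-clique, which an adjacent \<open>y\<close> would extend.\<close>
  have B_indep: "\<not> E x y" if i: "i \<in> {1..<p}" and xy: "x \<in> B i" "y \<in> B i" for i x y
  proof
    assume "E x y"
    then have "E y x" using simple_graph_sym[OF simple] by blast
    have "insert x (S - {f i}) \<in> K (Suc p)"
      using insert_common_in_cliques(1)[OF simple remove_from_clique(1)[OF simple S fH(1)[OF i]]] xy
      by (simp add: B_def)
    moreover have "y \<in> common V E (insert x (S - {f i}))"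
      using xy \<open>E y x\<close> by (auto simp: B_def common_def)
    ultimately show False using top_clique_maximal by blast
  qed
  \<comment> \<open>Independence gives one inclusion and both sets have \<open>m\<close> elements.
    Hence every vertex of \<open>B i\<close> is adjacent to everything outside
    \<open>B i\<close>.\<close>
  have B_nonnbrs: "nonnbrs V E w = B i" if i: "i \<in> {1..<p}" and w: "w \<in> B i" for i w
  proof -
    have "B i \<subseteq> nonnbrs V E w" using B_indep[OF i _ w] BV by (auto simp: nonnbrs_def)
    moreover have "card (B i) = card (nonnbrs V E w)"
      using B_card[OF i] nonnbrs_eq[of w] w BV[of i] by (metis of_nat_eq_iff subsetD)
    moreover have "finite (nonnbrs V E w)" using finite_V by (simp add: nonnbrs_def)
    ultimately show ?thesis using card_subset_eq by metis
  qed
  have B_disj: "i = j" if ij: "i \<in> {1..<p}" "j \<in> {1..<p}" and v: "v \<in> B i" "v \<in> B j" for i j v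
  proof (rule ccontr)
    assume "i \<noteq> j"
    \<comment> \<open>The facets missing \<open>f i\<close> and \<open>f j\<close> together cover
      \<open>S\<close>, so \<open>v\<close> would extend \<open>S\<close>.\<close>
    then have "f i \<noteq> f j" using f ij by (auto simp: bij_betw_def dest: inj_onD)
    then have "v \<in> common V E S" using v by (auto simp: B_def common_def)
    then show False using top_clique_maximal[OF S] by blast
  qed
  \<comment> \<open>The default value 0 puts the vertices outside all \<open>B i\<close> into
    \<open>V0\<close>.\<close>
  define part where "part v = (if \<exists>i\<in>{1..<p}. v \<in> B i then SOME i. i \<in> {1..<p} \<and> v \<in> B i else 0)" for v
  have part_eq: "part v = i \<longleftrightarrow> v \<in> B i" if i: "i \<in> {1..<p}" for v i
  proof (cases "\<exists>i\<in>{1..<p}. v \<in> B i")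
    case True
    then have "\<exists>i. i \<in> {1..<p} \<and> v \<in> B i" by blast
    from someI_ex[OF this] have "part v \<in> {1..<p}" "v \<in> B (part v)"
      using True by (simp_all add: part_def)
    then show ?thesis using B_disj[OF i] by blast
  next
    case False
    then have "part v = 0" by (simp only: part_def if_False)
    then show ?thesis using False i by auto
  qed
  have part_less: "part v < p" for v
  proof (cases "\<exists>i\<in>{1..<p}. v \<in> B i")
    case True
    then obtain i where "i \<in> {1..<p}" "v \<in> B i" by blast
    then show ?thesis using part_eq[of i v] by simp
  next
    case False
    then have "part v = 0" by (simp only: part_def if_False)
    then show ?thesis using p_ge by simp
  qed
  have part_set: "{v \<in> V. part v = i} = B i" if "i \<in> {1..<p}" for i
    using part_eq[OF that] BV by auto
  let ?V0 = "{v \<in> V. part v = 0}"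
  have complete: "E x y" if "x \<in> V" "y \<in> V" "part x \<noteq> part y" for x y
  proof -
    have *: "E b a" if "a \<in> V" "b \<in> V" "part a \<noteq> part b" "part a \<noteq> 0" for a b
    proof -
      have i: "part a \<in> {1..<p}" using that part_less[of a] by auto
      then have "nonnbrs V E a = B (part a)" using B_nonnbrs part_eq by blast
      moreover have "b \<notin> B (part a)" using part_eq[OF i] that by metis
      ultimately show ?thesis using that by (auto simp: nonnbrs_def)
    qed
    show ?thesis
    proof (cases "part x = 0")
      case True
      then show ?thesis using *[of y x] that by simp
    next
      case False
      then show ?thesis using *[of x y] that simple_graph_sym[OF simple, of x y] by simp
    qed
  qed
  have card_V0: "real (card ?V0) = n - (real p - 1) * m"
  proof -
    have "V = (\<Union>i\<in>{0..<p}. {v \<in> V. part v = i})" using part_less by auto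
    then have "card V = (\<Sum>i\<in>{0..<p}. card {v \<in> V. part v = i})"
      using finite_V by (subst card_UN_disjoint[symmetric]) auto
    also have "\<dots> = card ?V0 + (\<Sum>i\<in>{1..<p}. card {v \<in> V. part v = i})"
      using p_ge by (subst sum.atLeast_Suc_lessThan) auto
    finally have "n = real (card ?V0) + (\<Sum>i\<in>{1..<p}. real (card {v \<in> V. part v = i}))"
      by simp
    also have "(\<Sum>i\<in>{1..<p}. real (card {v \<in> V. part v = i})) = (\<Sum>i\<in>{1..<p}. m)"
      by (intro sum.cong refl) (simp only: part_set B_card)
    finally show ?thesis using real_p_minus_1 by simp
  qed
  have degree_V0: "real (degree ?V0 E v) = n - real p * m" if v: "v \<in> V" "part v = 0" for v
  proof -
    \<comment> \<open>All \<open>m\<close> non-neighbours of \<open>v\<close>, including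
      \<open>v\<close> itself, lie in \<open>V0\<close>, so its degree there is
      \<open>n - (p - 1) m - m\<close>.\<close>
    have sub: "nonnbrs V E v \<subseteq> ?V0" using complete[of _ v] v by (auto simp: nonnbrs_def)
    have "{u \<in> ?V0. E v u} = ?V0 - nonnbrs V E v"
      using simple_graph_sym[OF simple, of v] by (auto simp: nonnbrs_def)
    then have "real (degree ?V0 E v) = real (card ?V0 - card (nonnbrs V E v))"
      using sub finite_V by (simp add: degree_def card_Diff_subset finite_subset)
    also have "\<dots> = real (card ?V0) - real (card (nonnbrs V E v))"
      using sub finite_V by (intro of_nat_diff card_mono) auto
    finally show ?thesis using card_V0 nonnbrs_eq[OF v(1)] by (simp add: algebra_simps)
  qed
  \<comment> \<open>\<open>H\<close> has one vertex in each independent class. Two vertices of a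
    triangle in \<open>V0\<close> together with \<open>H\<close> form a (p + 1)-clique, which the
    third vertex would extend.\<close>
  have "cliques ?V0 E 3 = {}"
  proof (rule ccontr)
    assume "cliques ?V0 E 3 \<noteq> {}"
    then obtain T where T: "T \<subseteq> ?V0" "card T = 3" "\<forall>x\<in>T. \<forall>y\<in>T. x \<noteq> y \<longrightarrow> E x y"
      by (auto simp: cliques_def)
    then obtain x y z where xyz: "T = {x, y, z}" "x \<noteq> y" "x \<noteq> z" "y \<noteq> z"
      by (auto simp: card_3_iff)
    have H_part: "u \<in> V \<and> u \<in> S \<and> part u \<noteq> 0" if "u \<in> H" for u
    proof -
      obtain i where i: "i \<in> {1..<p}" "u = f i" using f \<open>u \<in> H\<close> unfolding bij_betw_def by blast
      then have "part u = i" using B_self part_eq by blast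
      then show ?thesis using i fH(1) SV by auto
    qed
    have S_clique: "\<forall>a\<in>S. \<forall>b\<in>S. a \<noteq> b \<longrightarrow> E a b" using S by (simp add: cliques_def)
    have out: "x \<notin> H" "y \<notin> H" using H_part[of x] H_part[of y] T(1) xyz(1) by auto
    have T_H: "E a u \<and> E u a" if "a \<in> T" "u \<in> H" for a u
      using complete[of a u] complete[of u a] H_part[OF that(2)] that(1) T(1) by auto
    have "insert x (insert y H) \<in> K (Suc p)"
      unfolding cliques_def
    proof (intro CollectI conjI)
      show "insert x (insert y H) \<subseteq> V" using T xyz H_part by auto
      show "card (insert x (insert y H)) = Suc p"
        using out xyz H(2) \<open>finite H\<close> p_ge by simp
      show "\<forall>a\<in>insert x (insert y H). \<forall>b\<in>insert x (insert y H). a \<noteq> b \<longrightarrow> E a b"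
        using T(3) xyz T_H S_clique H_part by (metis insert_iff)
    qed
    moreover have "z \<in> common V E (insert x (insert y H))"
      using T xyz T_H[of z] by (auto simp: common_def)
    ultimately show False using top_clique_maximal by blast
  qed
  then have "kcliques ?V0 E 3 = 0" by (simp add: kcliques_eq_card)
  moreover have "\<not> E x y" if "x \<in> V" "y \<in> V" "part x = part y" "1 \<le> part x" for x y
  proof -
    have i: "part x \<in> {1..<p}" using that part_less[of x] by simp
    then have "x \<in> B (part x)" "y \<in> B (part x)"
      using part_eq[OF i, of x] part_eq[OF i, of y] that(3) by metis+
    then show ?thesis using B_indep[OF i] by blast
  qed
  moreover have "\<And>i. i \<in> {1..<p} \<Longrightarrow> real (card {v \<in> V. part v = i}) = m"
    by (simp only: part_set B_card)
  ultimately show thesis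
    using that part_less card_V0 complete degree_V0 by blast
qed

end

end

section \<open>The extremal family\<close>

text \<open>Distributing \<open>n ^ s\<close> turns powers of \<open>\<beta>\<close> into powers of
  \<open>m = \<beta> n\<close> and a factor \<open>1 - q \<beta>\<close> into
  \<open>n - q m\<close>. From \<open>s = 2\<close> on, integer and natural subtraction
  agree.\<close>

lemma g_eq_ref:
  assumes "2 \<le> s" and p: "pnum \<beta> = int p" "1 \<le> p"
  shows "g (int s) \<beta> * real n ^ s = ref (p - 1) (real n) (\<beta> * real n) s"
proof -
  obtain j where s: "s = Suc (Suc j)" using assms by (metis add_2_eq_Suc le_Suc_ex)
  have nats: "nat (int s) = s" "nat (int s - 1) = Suc j" "nat (int s - 2) = j"
    using s by simp_all
  have b: "binom (int p - 1) (int i) = real ((p - 1) choose i)" for i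
    using p(2) by (simp add: binom_def binomial_eq_0 nat_diff_distrib)
  have ints: "int s - 1 = int (Suc j)" "int s - 2 = int j" using s by simp_all
  have q: "real (p - 1) = real p - 1" using p(2) by simp
  show ?thesis
    unfolding g_def ref_def Let_def p(1) nats unfolding ints b q
    by (simp add: s power_mult_distrib field_simps)
qed

lemma family_witness_iff:
  assumes "pnum \<beta> = int p"
  shows "family_witness V E \<beta> part \<longleftrightarrow>
    (let n = real (card V); m = \<beta> * n; V0 = {v \<in> V. part v = 0} in
      (\<forall>v\<in>V. part v < p) \<and> real (card V0) = n - real (p - 1) * m \<and>
      (\<forall>i\<in>{1..<p}. real (card {v \<in> V. part v = i}) = m) \<and>
      (\<forall>x\<in>V. \<forall>y\<in>V. part x \<noteq> part y \<longrightarrow> E x y) \<and>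
      (\<forall>x\<in>V. \<forall>y\<in>V. part x = part y \<and> part x \<ge> 1 \<longrightarrow> \<not> E x y) \<and>
      regular V0 E (n - real p * m) \<and>
      (\<forall>F :: nat \<Rightarrow> nat \<Rightarrow> bool. simple_graph {0..<card V0} F \<and> regular {0..<card V0} F (n - real p * m)
         \<longrightarrow> kcliques V0 E 3 \<le> kcliques {0..<card V0} F 3))"
  by (simp add: family_witness_def Let_def assms left_diff_distrib mult.assoc)

text \<open>Isomorphism invariance, which links an arbitrary vertex set to the sets
  \<open>{0..<n}\<close> in \<open>feasible\<close>. The minimality clause depends only on the order
  of \<open>V0\<close>, its required degree and its number of triangles.\<close>

lemma family_witness_bij:
  assumes h: "bij_betw h A B" and F: "\<And>x y. x \<in> A \<Longrightarrow> y \<in> A \<Longrightarrow> F x y \<longleftrightarrow> E (h x) (h y)"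
    and w: "family_witness B E \<beta> part"
  shows "family_witness A F \<beta> (\<lambda>x. part (h x))"
    and "kcliques {v \<in> A. part (h v) = 0} F 3 = kcliques {v \<in> B. part v = 0} E 3"
proof -
  have im: "h ` A = B" using h by (auto simp: bij_betw_def)
  have hB: "\<And>x. x \<in> A \<Longrightarrow> h x \<in> B" using im by blast
  have sub: "bij_betw h {v \<in> A. part (h v) = i} {v \<in> B. part v = i}" for i
    using h by (auto simp: bij_betw_def intro: inj_on_subset)
  have cards: "card {v \<in> A. part (h v) = i} = card {v \<in> B. part v = i}" for i
    by (rule bij_betw_same_card[OF sub])
  have cardA: "card A = card B" by (rule bij_betw_same_card[OF h])
  show K: "kcliques {v \<in> A. part (h v) = 0} F 3 = kcliques {v \<in> B. part v = 0} E 3"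
    by (rule kcliques_bij[OF sub]) (auto simp: F)
  have deg: "degree {v \<in> A. part (h v) = 0} F v = degree {v \<in> B. part v = 0} E (h v)"
    if "v \<in> A" for v
    using that by (intro degree_bij[OF sub]) (auto simp: F)
  have reg: "regular {v \<in> A. part (h v) = 0} F r" if "regular {v \<in> B. part v = 0} E r" for r
    using that deg hB by (simp add: regular_def)
  show "family_witness A F \<beta> (\<lambda>x. part (h x))"
    using w reg hB unfolding family_witness_def Let_def K cards cardA by (simp add: F)
qed

lemma restricted_simple_graph:
  assumes "simple_graph B E" "finite A" "h ` A \<subseteq> B"
  shows "simple_graph A (\<lambda>x y. x \<in> A \<and> y \<in> A \<and> E (h x) (h y))"
  using assms(2,3) simple_graph_sym[OF assms(1)] simple_graph_irrefl[OF assms(1)]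
  by (simp add: simple_graph_def)

lemma feasible_family_imp_triangle_free:
  assumes "feasible (card V) \<beta>" "simple_graph V E" "family_witness V E \<beta> part"
  shows "kcliques {v \<in> V. part v = 0} E 3 = 0"
proof -
  have feas: "kcliques {v \<in> {0..<card V}. q v = 0} F 3 = 0"
    if "simple_graph {0..<card V} F" "family_witness {0..<card V} F \<beta> q" for F q
    using assms(1) that unfolding feasible_def by blast
  obtain h where h: "bij_betw h {0..<card V} V"
    using ex_bij_betw_nat_finite[OF simple_graph_finite[OF assms(2)]] by blast
  let ?F = "\<lambda>x y. x \<in> {0..<card V} \<and> y \<in> {0..<card V} \<and> E (h x) (h y)"
  have F: "simple_graph {0..<card V} ?F"
    using h by (intro restricted_simple_graph[OF assms(2)]) (auto simp: bij_betw_def)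
  note b = family_witness_bij[OF h _ assms(3), of ?F]
  have "family_witness {0..<card V} ?F \<beta> (\<lambda>x. part (h x))" by (rule b) simp
  then have "kcliques {v \<in> {0..<card V}. part (h v) = 0} ?F 3 = 0"
    by (rule feas[OF F])
  moreover have "kcliques {v \<in> {0..<card V}. part (h v) = 0} ?F 3 = kcliques {v \<in> V. part v = 0} E 3"
    by (rule b) simp
  ultimately show ?thesis by simp
qed

text \<open>A copy of the triangle-free \<open>V0\<close> on an initial segment competes in the
  minimality clause of every other member of the family, so that member has no triangle in its own
  \<open>V0\<close> either.\<close>

lemma feasible_if_triangle_free:
  assumes p: "pnum \<beta> = int p" and fam: "family_defined (card V) \<beta>" and G: "simple_graph V E"
    and w: "family_witness V E \<beta> part" and tf: "kcliques {v \<in> V. part v = 0} E 3 = 0"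
  shows "feasible (card V) \<beta>"
  unfolding feasible_def
proof (intro conjI allI impI fam)
  fix E' :: "nat \<Rightarrow> nat \<Rightarrow> bool" and part'
  assume "simple_graph {0..<card V} E' \<and> family_witness {0..<card V} E' \<beta> part'"
  then have w': "family_witness {0..<card V} E' \<beta> part'" by simp
  let ?V0 = "{v \<in> V. part v = 0}" and ?V0' = "{v \<in> {0..<card V}. part' v = 0}"
  have "real (card ?V0') = real (card ?V0)"
    using w w' unfolding family_witness_iff[OF p] Let_def by simp
  then have c: "card ?V0' = card ?V0" by simp
  have fV0: "finite ?V0" using simple_graph_finite[OF G] by simp
  obtain h where h: "bij_betw h {0..<card ?V0} ?V0"
    using ex_bij_betw_nat_finite[OF fV0] by blast
  define F where "F x y \<longleftrightarrow> x \<in> {0..<card ?V0} \<and> y \<in> {0..<card ?V0} \<and> E (h x) (h y)" for x y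
  have F: "simple_graph {0..<card ?V0} F"
    unfolding F_def using h by (intro restricted_simple_graph[OF G]) (auto simp: bij_betw_def)
  have "degree {0..<card ?V0} F v = degree ?V0 E (h v)" if "v \<in> {0..<card ?V0}" for v
    using that by (intro degree_bij[OF h]) (auto simp: F_def)
  moreover have "h v \<in> ?V0" if "v \<in> {0..<card ?V0}" for v
    using h that by (auto simp: bij_betw_def)
  moreover have "regular ?V0 E (real (card V) - real p * (\<beta> * real (card V)))"
    using w unfolding family_witness_iff[OF p] Let_def by blast
  ultimately have "regular {0..<card ?V0'} F (real (card V) - real p * (\<beta> * real (card V)))"
    unfolding c regular_def by simp
  then have "kcliques ?V0' E' 3 \<le> kcliques {0..<card ?V0'} F 3"
    using w' F unfolding family_witness_iff[OF p] Let_def c by (simp only: card_atLeastLessThan diff_zero)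
  also have "\<dots> = kcliques ?V0 E 3"
    unfolding c by (rule kcliques_bij[OF h]) (auto simp: F_def)
  finally show "kcliques ?V0' E' 3 = 0" using tf by simp
qed

lemma (in dense_graph) feasible_family_if_tight:
  assumes tight: "k 2 = top_density * R 2" and m: "m = \<beta> * n" and p: "pnum \<beta> = int p"
  shows "feasible (card V) \<beta> \<and> in_family V E \<beta>"
proof (rule extremal_partition[OF tight], goal_cases)
  case (1 part)
  note part = this
  \<comment> \<open>The minimality clause holds because a count of zero triangles cannot be
    undercut.\<close>
  have w: "family_witness V E \<beta> part"
    unfolding family_witness_iff[OF p] Let_def m[symmetric] real_p_minus_1 regular_def
    by (intro conjI ballI allI impI) (use part in simp_all)
  have fam: "family_defined (card V) \<beta>"
  proof -
    have pos: "0 < n - real 1 * m" using base_pos[of 1] p_ge by simp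
    then have "0 < n" using m_pos by simp
    then obtain v where "v \<in> V" by fastforce
    have deg: "real (degree V E w) = n - m" if "w \<in> V" for w
      using nonnbrs_eq[OF tight that] card_nonnbrs[OF simple, of w] by simp
    have "degree V E w = degree V E v" if "w \<in> V" for w
      using deg[OF that] deg[OF \<open>v \<in> V\<close>] by simp
    \<comment> \<open>For a regular graph the handshake lemma makes the product of order and degree
      even, which is the parity condition of the family.\<close>
    then have "card V * degree V E v = 2 * kcliques V E 2"
      using sum_degree_eq[OF simple] by simp
    then have "even (card V * degree V E v)" by simp
    then have "\<not> (odd (card V) \<and> odd (degree V E v))" by simp
    moreover have "real (degree V E v) = (1 - \<beta>) * n"
      using deg[OF \<open>v \<in> V\<close>] m by (simp add: left_diff_distrib)
    moreover have "0 < degree V E v" using deg[OF \<open>v \<in> V\<close>] pos by simp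
    ultimately show ?thesis using \<open>0 < n\<close> unfolding family_defined_def by auto
  qed
  have "in_family V E \<beta>" using fam simple w by (auto simp: in_family_def)
  moreover have "feasible (card V) \<beta>"
    by (rule feasible_if_triangle_free[OF p fam simple w part(7)])
  ultimately show ?thesis by simp
qed

lemma kcliques_feasible_family:
  assumes feas: "feasible (card V) \<beta>" and fam: "in_family V E \<beta>" and p: "pnum \<beta> = int p" "2 \<le> p"
  shows "real (kcliques V E (Suc p)) = ref (p - 1) (real (card V)) (\<beta> * real (card V)) (Suc p)"
    and "real (kcliques V E 2) = ref (p - 1) (real (card V)) (\<beta> * real (card V)) 2"
proof -
  obtain part where G: "simple_graph V E" and w: "family_witness V E \<beta> part"
    using fam by (auto simp: in_family_def)
  have tf: "kcliques {v \<in> V. part v = 0} E 3 = 0"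
    by (rule feasible_family_imp_triangle_free[OF feas G w])
  have q: "real (p - 1) = real p - 1" using p by simp
  note w' = w[unfolded family_witness_iff[OF p(1)] Let_def regular_def q]
  show "real (kcliques V E (Suc p)) = ref (p - 1) (real (card V)) (\<beta> * real (card V)) (Suc p)"
    by (rule kcliques_extremal(1)[OF G p(2), of part]) (use w' tf in blast)+
  show "real (kcliques V E 2) = ref (p - 1) (real (card V)) (\<beta> * real (card V)) 2"
    by (rule kcliques_extremal(2)[OF G p(2), of part]) (use w' tf in blast)+
qed

theorem mainTheorem8:
  fixes V :: "'a set" and E :: "'a \<Rightarrow> 'a \<Rightarrow> bool" and \<beta> :: real and t :: nat
  assumes "0 < \<beta>" and "\<beta> < 1"
    and "simple_graph V E" and "V \<noteq> {}"
    and "real (min_degree V E) = (1 - \<beta>) * real (card V)"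
    and "2 \<le> t" and "int t \<le> pnum \<beta>"
  shows "real (kcliques V E (nat (pnum \<beta> + 1))) / (g (pnum \<beta> + 1) \<beta> * real (card V) ^ nat (pnum \<beta> + 1))
           \<ge> real (kcliques V E t) / (g (int t) \<beta> * real (card V) ^ t)
       \<and> (t = 2 \<longrightarrow>
           (real (kcliques V E (nat (pnum \<beta> + 1))) / (g (pnum \<beta> + 1) \<beta> * real (card V) ^ nat (pnum \<beta> + 1))
              = real (kcliques V E 2) / (g 2 \<beta> * real (card V) ^ 2)
            \<longleftrightarrow> feasible (card V) \<beta> \<and> in_family V E \<beta>))"
proof -
  define p where "p = nat (pnum \<beta>)"
  have p: "pnum \<beta> = int p" "2 \<le> p" and tp: "t \<le> p" using assms(6,7) by (auto simp: p_def)
  have fV: "finite V" by (rule simple_graph_finite[OF assms(3)])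
  have npos: "0 < card V" using fV assms(4) by (simp add: card_gt_0_iff)
  interpret dense_graph V E p "\<beta> * real (card V)"
  proof
    \<comment> \<open>The ceiling places \<open>1 / \<beta>\<close> in the half-open interval from
      \<open>p\<close> to \<open>p + 1\<close>; scaled by \<open>\<beta> n\<close>, these are the
      bounds of the locale.\<close>
    have "int p + 1 = \<lceil>1 / \<beta>\<rceil>" using p(1) by (simp add: pnum_def)
    then have "real p < 1 / \<beta>" "1 / \<beta> \<le> real p + 1" by linarith+
    then have b: "real p * \<beta> < 1" "1 \<le> (real p + 1) * \<beta>"
      using assms(1) by (simp_all add: field_simps)
    show "real p * (\<beta> * real (card V)) < real (card V)"
      using mult_strict_right_mono[OF b(1), of "real (card V)"] npos by (simp add: mult.assoc)
    show "real (card V) \<le> (real p + 1) * (\<beta> * real (card V))"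
      using mult_right_mono[OF b(2), of "real (card V)"] by (simp add: mult.assoc)
    show "simple_graph V E" "2 \<le> p" by fact+
    fix v assume "v \<in> V"
    then have "min_degree V E \<le> degree V E v"
      using fV by (simp add: min_degree_def)
    then have "real (min_degree V E) \<le> real (degree V E v)" by simp
    then show "real (card V) - \<beta> * real (card V) \<le> real (degree V E v)"
      using assms(5) by (simp add: left_diff_distrib)
  qed
  have g: "g (int s) \<beta> * real (card V) ^ s = R s" if "2 \<le> s" for s
    using g_eq_ref[OF that p(1)] p(2) by simp
  have top: "real (kcliques V E (nat (pnum \<beta> + 1))) / (g (pnum \<beta> + 1) \<beta> * real (card V) ^ nat (pnum \<beta> + 1))
      = top_density"
  proof -
    have "pnum \<beta> + 1 = int (Suc p)" using p(1) by simp
    then show ?thesis using g[of "Suc p"] p(2) by (simp only: nat_int top_density_def)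
  qed
  have "k t / R t \<le> top_density"
    using clique_density[of t] R_pos[of t] tp assms(6) by (simp add: pos_divide_le_eq)
  then have ineq: "real (kcliques V E t) / (g (int t) \<beta> * real (card V) ^ t) \<le> top_density"
    using g[OF assms(6)] by simp
  have R2: "0 < R 2" using R_pos[of 2] p(2) by simp
  have "g 2 \<beta> * real (card V) ^ 2 = R 2" using g[of 2] by simp
  then have "real (kcliques V E 2) / (g 2 \<beta> * real (card V) ^ 2) = k 2 / R 2" by (simp only:)
  moreover have "top_density = k 2 / R 2 \<longleftrightarrow> k 2 = top_density * R 2"
    using R2 by (auto simp: field_simps)
  moreover have "k 2 = top_density * R 2 \<longleftrightarrow> feasible (card V) \<beta> \<and> in_family V E \<beta>"
  proof
    assume "k 2 = top_density * R 2"
    then show "feasible (card V) \<beta> \<and> in_family V E \<beta>"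
      by (rule feasible_family_if_tight) (simp_all add: p)
  next
    \<comment> \<open>Here both clique counts equal the reference values, so
      \<open>top_density\<close> is 1.\<close>
    assume "feasible (card V) \<beta> \<and> in_family V E \<beta>"
    then have "k (Suc p) = R (Suc p)" "k 2 = R 2"
      using kcliques_feasible_family[OF _ _ p] by blast+
    then show "k 2 = top_density * R 2"
      using R_pos[of "Suc p"] p(2) by (simp add: top_density_def)
  qed
  ultimately have "top_density = real (kcliques V E 2) / (g 2 \<beta> * real (card V) ^ 2)
      \<longleftrightarrow> feasible (card V) \<beta> \<and> in_family V E \<beta>"
    by (simp only:)
  then show ?thesis unfolding top using ineq by blast
qed

end
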